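(* Let $G$ be a connected strongly regular graph. Perfect state transfer occurs between $\mathbf{x}=\mathbf{e}_u+s\,\mathbf{e}_v$ and $\mathbf{y}=\mathbf{e}_w+s\,\mathbf{e}_z$ in $G$ if and only if one of the following holds. 1. $G=C_4$, between $\mathbf{e}_u+\mathbf{e}_v$ and $\mathbf{e}_w+\mathbf{e}_z$, where $u\not\sim v$ and $w\not\sim z$. 2. $G=CP(2m)$, between (i) $\mathbf{e}_u-\mathbf{e}_v$ and $\mathbf{e}_w-\mathbf{e}_z$ for all $m\geq 2$, where $u\not\sim z$ and $v\not\sim w$; or (ii) $\mathbf{e}_u+s\,\mathbf{e}_v$ and $\mathbf{e}_w+s\,\mathbf{e}_z$ for all even $m\geq 2$, where $u\not\sim w$ and $v\not\sim z$. 3. $G=\overline{\bigcup_m K_3}$ for all even $m$, between (i) $\mathbf{e}_u+\tfrac12\mathbf{e}_v$ and $\mathbf{e}_w+\tfrac12\mathbf{e}_v$, or (ii) $2\mathbf{e}_u+\mathbf{e}_v$ and $2\mathbf{e}_w+\mathbf{e}_v$, where $u,v,w$ belong to the same partite set. 4. $G=\overline{\bigcup_m K_4}$ for all even $m$, between $\mathbf{e}_u+\mathbf{e}_v$ and $\mathbf{e}_w+\mathbf{e}_z$. The minimum PST times in 1, 2, 3 and 4 are $\frac{\pi}{4}$, $\frac{\pi}{2}$, $\frac{\pi}{3}$ and $\frac{\pi}{4}$, respectively.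
   Context: A strongly regular graph with parameters $(n,k,a,c)$ is an (unweighted simple) $k$-regular graph on $n$ vertices in which each pair of adjacent vertices has $a$ common neighbours and each pair of non-adjacent vertices has $c$ common neighbours; it is assumed that $2\le k\le n-2$. $\overline{\bigcup_m K_n}$ is the complete multipartite graph with $m$ partite sets of size $n$ ($m,n\ge2$), $CP(2m)=\overline{\bigcup_m K_2}$ is the cocktail party graph on $2m$ vertices, and $C_4$ is the 4-cycle. $a\not\sim b$ means that $a$ and $b$ are distinct non-adjacent vertices, and $\mathbf{e}_a$ is the characteristic vector of vertex $a$. The vectors $\mathbf{x},\mathbf{y}$ are $s$-pair states, i.e. $u\ne v$ and $w\neq z$ are vertices of $G$ and $s\in\mathbb{R}\setminus\{0\}$ (normalization is omitted), and $\mathbf{y}\neq\pm\mathbf{x}$. With $A$ the adjacency matrix and $U_G(t)=\exp(itA)$ (the Laplacian and signless Laplacian give the same state transfer since $G$ is regular), perfect state transfer (PST) occurs between real vectors $\mathbf{x}$ and $\mathbf{y}$ at time $\tau>0$ if $U_G(\tau)\mathbf{x}=\gamma\mathbf{y}$ for some $\gamma\in\mathbb{C}$; the minimum PST time is the least such $\tau$.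
   Formalization: In item 4 the condition that u,v,w,z are the four vertices of one partite set is added (without it the claim fails, e.g. u,v in different parts of K_{4,4}); in items 1–4 states are matched up to sign and renaming of the vertices. *)

theory Defs
  imports "HOL-Analysis.Analysis"
begin

section \<open>Graphs\<close>

text \<open>A graph on the finite vertex type \<open>'v\<close> is given by its adjacency relation.\<close>

definition simple_graph :: "('v \<Rightarrow> 'v \<Rightarrow> bool) \<Rightarrow> bool" where
  "simple_graph adj \<longleftrightarrow> (\<forall>u. \<not> adj u u) \<and> (\<forall>u v. adj u v \<longrightarrow> adj v u)"

definition nonadj :: "('v \<Rightarrow> 'v \<Rightarrow> bool) \<Rightarrow> 'v \<Rightarrow> 'v \<Rightarrow> bool" where
  "nonadj adj u v \<longleftrightarrow> u \<noteq> v \<and> \<not> adj u v"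

definition connected_graph :: "('v \<Rightarrow> 'v \<Rightarrow> bool) \<Rightarrow> bool" where
  "connected_graph adj \<longleftrightarrow> (\<forall>u v. rtranclp adj u v)"

definition common_nbrs :: "('v \<Rightarrow> 'v \<Rightarrow> bool) \<Rightarrow> 'v \<Rightarrow> 'v \<Rightarrow> 'v set" where
  "common_nbrs adj u v = {x. adj u x \<and> adj v x}"

text \<open>The bound \<open>k + 2 \<le> n\<close> is \<open>k \<le> n - 2\<close> without truncated subtraction.\<close>

definition strongly_regular ::
  "('v::finite \<Rightarrow> 'v \<Rightarrow> bool) \<Rightarrow> nat \<Rightarrow> nat \<Rightarrow> nat \<Rightarrow> nat \<Rightarrow> bool" where
  "strongly_regular adj n k a c \<longleftrightarrow>
     simple_graph adj \<and> CARD('v) = n \<and> 2 \<le> k \<and> k + 2 \<le> n \<and>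
     (\<forall>u. card {v. adj u v} = k) \<and>
     (\<forall>u v. adj u v \<longrightarrow> card (common_nbrs adj u v) = a) \<and>
     (\<forall>u v. nonadj adj u v \<longrightarrow> card (common_nbrs adj u v) = c)"

definition is_C4 :: "('v \<Rightarrow> 'v \<Rightarrow> bool) \<Rightarrow> bool" where
  "is_C4 adj \<longleftrightarrow> (\<exists>f :: nat \<Rightarrow> 'v. bij_betw f {..<4} UNIV \<and>
     (\<forall>i<4. \<forall>j<4. adj (f i) (f j) \<longleftrightarrow> j = (i + 1) mod 4 \<or> i = (j + 1) mod 4))"

text \<open>The graph is complete multipartite, and \<open>P\<close> is the set of its \<open>m\<close> partite sets,
  each of size \<open>n\<close>.\<close>

definition complete_multipartite ::
  "('v::finite \<Rightarrow> 'v \<Rightarrow> bool) \<Rightarrow> 'v set set \<Rightarrow> nat \<Rightarrow> nat \<Rightarrow> bool" where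
  "complete_multipartite adj P m n \<longleftrightarrow>
     2 \<le> m \<and> 2 \<le> n \<and> partition_on UNIV P \<and> card P = m \<and> (\<forall>p\<in>P. card p = n) \<and>
     (\<forall>u v. adj u v \<longleftrightarrow> \<not> (\<exists>p\<in>P. u \<in> p \<and> v \<in> p))"

definition is_CP :: "('v::finite \<Rightarrow> 'v \<Rightarrow> bool) \<Rightarrow> nat \<Rightarrow> bool" where
  "is_CP adj m \<longleftrightarrow> (\<exists>P. complete_multipartite adj P m 2)"

section \<open>Quantum walks\<close>

text \<open>The type of square matrices carries a componentwise product and is not an instance of
  \<open>real_normed_algebra_1\<close>, so the library's \<open>exp\<close> does not apply; the exponential is the
  usual power series with respect to the matrix product.\<close>

definition mat_pow :: "complex^'v^'v \<Rightarrow> nat \<Rightarrow> complex^'v^'v" where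
  "mat_pow M k = (((**) M) ^^ k) (mat 1)"

definition mat_exp :: "complex^'v::finite^'v \<Rightarrow> complex^'v^'v" where
  "mat_exp M = (\<Sum>k. (1 / fact k) *\<^sub>R mat_pow M k)"

lemma mat_exp_sums:
  fixes M :: "complex^'v::finite^'v"
  shows "(\<lambda>k. (1 / fact k) *\<^sub>R mat_pow M k) sums mat_exp M"
proof -
  have bil: "bilinear ((**) :: complex^'v^'v \<Rightarrow> complex^'v^'v \<Rightarrow> complex^'v^'v)"
    unfolding bilinear_def
    by (auto intro!: linearI simp: matrix_add_ldistrib
        matrix_matrix_mult_def vec_eq_iff scaleR_sum_right sum.distrib algebra_simps)
  obtain K where K: "K > 0" "norm (A ** B) \<le> norm A * norm B * K" for A B :: "complex^'v^'v"
    using bounded_bilinear.pos_bounded[OF bil[unfolded bilinear_conv_bounded_bilinear]] by auto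
  have pow: "norm (mat_pow M k) \<le> norm (mat 1 :: complex^'v^'v) * (norm M * K) ^ k" for k
  proof (induction k)
    case (Suc k)
    have "norm (mat_pow M (Suc k)) \<le> norm (mat_pow M k) * (norm M * K)"
      using K(2)[of M "mat_pow M k"] by (simp add: mat_pow_def mult_ac)
    also have "\<dots> \<le> (norm (mat 1 :: complex^'v^'v) * (norm M * K) ^ k) * (norm M * K)"
      using Suc.IH K(1) by (intro mult_right_mono) auto
    finally show ?case by (simp add: mult_ac)
  qed (simp add: mat_pow_def)
  have "summable (\<lambda>k. norm (mat 1 :: complex^'v^'v) * ((norm M * K) ^ k /\<^sub>R fact k))"
    by (intro summable_mult summable_exp_generic)
  then have "summable (\<lambda>k. (1 / fact k) *\<^sub>R mat_pow M k)"
  proof (rule summable_comparison_test'[where N = 0])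
    fix k
    show "norm ((1 / fact k) *\<^sub>R mat_pow M k)
        \<le> norm (mat 1 :: complex^'v^'v) * ((norm M * K) ^ k /\<^sub>R fact k)"
      using pow[of k] by (simp add: field_simps)
  qed
  then show ?thesis
    unfolding mat_exp_def by (rule summable_sums)
qed

definition adj_matrix :: "('v::finite \<Rightarrow> 'v \<Rightarrow> bool) \<Rightarrow> real^'v^'v" where
  "adj_matrix adj = (\<chi> u v. if adj u v then 1 else 0)"

definition transition_matrix :: "('v::finite \<Rightarrow> 'v \<Rightarrow> bool) \<Rightarrow> real \<Rightarrow> complex^'v^'v" where
  "transition_matrix adj t =
     mat_exp (map_matrix (\<lambda>r. \<i> * of_real t * of_real r) (adj_matrix adj))"

definition cvec :: "real^'v \<Rightarrow> complex^'v" where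
  "cvec x = (\<chi> u. of_real (x $ u))"

definition pst_at ::
  "('v::finite \<Rightarrow> 'v \<Rightarrow> bool) \<Rightarrow> real^'v \<Rightarrow> real^'v \<Rightarrow> real \<Rightarrow> bool" where
  "pst_at adj x y \<tau> \<longleftrightarrow>
     \<tau> > 0 \<and> (\<exists>\<gamma>::complex. transition_matrix adj \<tau> *v cvec x = \<gamma> *s cvec y)"

definition pst :: "('v::finite \<Rightarrow> 'v \<Rightarrow> bool) \<Rightarrow> real^'v \<Rightarrow> real^'v \<Rightarrow> bool" where
  "pst adj x y \<longleftrightarrow> (\<exists>\<tau>. pst_at adj x y \<tau>)"

definition min_pst_time ::
  "('v::finite \<Rightarrow> 'v \<Rightarrow> bool) \<Rightarrow> real^'v \<Rightarrow> real^'v \<Rightarrow> real \<Rightarrow> bool" where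
  "min_pst_time adj x y \<tau> \<longleftrightarrow> pst_at adj x y \<tau> \<and> (\<forall>t. pst_at adj x y t \<longrightarrow> \<tau> \<le> t)"

section \<open>The four families of states\<close>

text \<open>The characteristic vector of a vertex.\<close>

abbreviation ev :: "'v::finite \<Rightarrow> real^'v" where
  "ev u \<equiv> axis u 1"

text \<open>Vectors differing by a sign represent the same state, and a pair state does not
  determine the labels of its vertices: \<open>ev u + s *\<^sub>R ev v\<close> equals \<open>s *\<^sub>R ev v + ev u\<close>, and
  \<open>ev u - ev v\<close> is \<open>ev v - ev u\<close> up to sign. The vertices in the families below are
  therefore existentially quantified, and the two states are matched up to sign. For
  instance, for odd \<open>m\<close> and adjacent \<open>u\<close>, \<open>v\<close> with antipodes \<open>u'\<close>, \<open>v'\<close> in \<open>CP(2m)\<close>, the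
  state \<open>ev u - ev v\<close> is transferred to \<open>ev v' - ev u'\<close>, hence also to \<open>ev u' - ev v'\<close>.\<close>

definition same_state :: "real^'v \<Rightarrow> real^'v \<Rightarrow> bool" where
  "same_state x y \<longleftrightarrow> x = y \<or> x = - y"

definition C4_states ::
  "('v::finite \<Rightarrow> 'v \<Rightarrow> bool) \<Rightarrow> real^'v \<Rightarrow> real^'v \<Rightarrow> bool" where
  "C4_states adj x y \<longleftrightarrow> is_C4 adj \<and>
     (\<exists>u v w z. nonadj adj u v \<and> nonadj adj w z \<and>
        same_state x (ev u + ev v) \<and> same_state y (ev w + ev z))"

definition CP_states ::
  "('v::finite \<Rightarrow> 'v \<Rightarrow> bool) \<Rightarrow> real^'v \<Rightarrow> real^'v \<Rightarrow> bool" where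
  "CP_states adj x y \<longleftrightarrow> (\<exists>m\<ge>2. is_CP adj m \<and>
     ((\<exists>u v w z. u \<noteq> v \<and> w \<noteq> z \<and> nonadj adj u z \<and> nonadj adj v w \<and>
         same_state x (ev u - ev v) \<and> same_state y (ev w - ev z)) \<or>
      (even m \<and>
       (\<exists>u v w z s. u \<noteq> v \<and> w \<noteq> z \<and> s \<noteq> 0 \<and> nonadj adj u w \<and> nonadj adj v z \<and>
         same_state x (ev u + s *\<^sub>R ev v) \<and> same_state y (ev w + s *\<^sub>R ev z)))))"

definition K3_states ::
  "('v::finite \<Rightarrow> 'v \<Rightarrow> bool) \<Rightarrow> real^'v \<Rightarrow> real^'v \<Rightarrow> bool" where
  "K3_states adj x y \<longleftrightarrow> (\<exists>m P. even m \<and> complete_multipartite adj P m 3 \<and>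
     (\<exists>u v w. u \<noteq> v \<and> w \<noteq> v \<and> (\<exists>p\<in>P. {u, v, w} \<subseteq> p) \<and>
        (same_state x (ev u + (1/2) *\<^sub>R ev v) \<and> same_state y (ev w + (1/2) *\<^sub>R ev v) \<or>
         same_state x (2 *\<^sub>R ev u + ev v) \<and> same_state y (2 *\<^sub>R ev w + ev v))))"

text \<open>Here the four vertices are the vertices of one partite set \<open>K\<^sub>4\<close>; without this condition
  there is no transfer.\<close>

definition K4_states ::
  "('v::finite \<Rightarrow> 'v \<Rightarrow> bool) \<Rightarrow> real^'v \<Rightarrow> real^'v \<Rightarrow> bool" where
  "K4_states adj x y \<longleftrightarrow> (\<exists>m P. even m \<and> complete_multipartite adj P m 4 \<and>
     (\<exists>u v w z. {u, v, w, z} \<in> P \<and>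
        same_state x (ev u + ev v) \<and> same_state y (ev w + ev z)))"

end

(* A strongly regular graph has the eigenvalues k, Theta, Lambda, so a state splits into its mean and
  two eigencomponents X1, X2, and transfer from x to y forces each component of y to be plus or
  minus that of x. If both non-constant components flip, then x + y is constant and n = 4.
  If exactly one of them flips, the signs amount to an equation 2 A x = d x + e y + const, with
  d = a - c and e = D or e = -D where D = Theta - Lambda. Comparing its entries at the at most four
  vertices of the two states and at the remaining vertices shows that c = k, i.e. the graph is
  complete multipartite, and that y = R x or, when the entries of x sum to 0, y = -R x for an
  explicit reflection R. The support of x + R x is a union of parts, which bounds the part size by 4
  and leaves the listed families; the evenness of m and the minimum times come from the phases at
  the eigenvalues 0, -p and p(m - 1), where m is the number and p the size of the parts. *)

theory Submission
  imports Defs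
begin

section \<open>Exponentials on eigenvectors\<close>

text \<open>Signs arise because the states are real: a component of y is a unimodular multiple of
  that of x, and a real number of modulus one is 1 or -1. The multiple is unimodular because both
  states carry the weights 1 and s and so have equal norms. The left side 2 A x takes only the
  values 0, 2, 2s and 2 + 2s, so each entry of the equation leaves few values for d, e and the
  constant. Spurious values are excluded mainly by a + 2 \<le> k, used as D^2 \<noteq> (d + 2)^2,
  and by comparing degrees. The target for s \<noteq> -1 is e = d: then D^2 = d^2, which says c = k.
  The constant is a nonzero multiple of the mean, because k differs from \<Theta> and \<Lambda>; so
  it vanishes exactly for s = -1. Such a state has no component at the eigenvalue k. This is why y =
  -R x becomes possible and why the parity of m no longer matters there. On a complete multipartite
  graph R is twice the averaging over parts minus the identity. The transfer on the 4-cycle in time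
  pi / 4 is separate: its state is fixed by R and is sent to its complement.\<close>

lemma mat_pow_eigenvector:
  assumes "M *v x = \<mu> *s x"
  shows "mat_pow M j *v x = \<mu> ^ j *s x"
proof (induction j)
  case 0
  show ?case by (simp add: mat_pow_def)
next
  case (Suc j)
  have "mat_pow M (Suc j) *v x = M *v (mat_pow M j *v x)"
    by (simp add: mat_pow_def matrix_vector_mul_assoc)
  also have "\<dots> = \<mu> ^ j *s (M *v x)"
    by (simp add: Suc.IH vector_scalar_commute)
  finally show ?case
    by (simp add: assms mult.commute)
qed

text \<open>Taking an entry of \<open>B *v x\<close> is bounded and linear in \<open>B\<close>, so
  it passes through the matrix series and leaves a scalar exponential series.\<close>

lemma mat_exp_eigenvector:
  fixes M :: "complex^'v::finite^'v"
  assumes "M *v x = \<mu> *s x"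
  shows "mat_exp M *v x = exp \<mu> *s x"
proof -
  have "(mat_exp M *v x) $ i = (exp \<mu> *s x) $ i" for i
  proof -
    have lin: "linear (\<lambda>B :: complex^'v^'v. (B *v x) $ i)"
      by (auto intro!: linearI simp: matrix_vector_mult_def sum.distrib algebra_simps
          scaleR_sum_right)
    have "(\<lambda>j. (((1 / fact j) *\<^sub>R mat_pow M j) *v x) $ i) sums (mat_exp M *v x) $ i"
      by (rule bounded_linear.sums[OF lin[unfolded linear_conv_bounded_linear] mat_exp_sums])
    moreover have "(((1 / fact j) *\<^sub>R mat_pow M j) *v x) $ i = (\<mu> ^ j /\<^sub>R fact j) * x $ i" for j
    proof -
      have "(((1 / fact j) *\<^sub>R mat_pow M j) *v x) $ i = (1 / fact j) *\<^sub>R (mat_pow M j *v x) $ i"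
        using linear_cmul[OF lin] by simp
      then show ?thesis
        by (simp add: mat_pow_eigenvector[OF assms] divide_inverse)
    qed
    ultimately have "(\<lambda>j. (\<mu> ^ j /\<^sub>R fact j) * x $ i) sums (mat_exp M *v x) $ i"
      by simp
    moreover have "(\<lambda>j. (\<mu> ^ j /\<^sub>R fact j) * x $ i) sums (exp \<mu> * x $ i)"
      by (intro sums_mult2 exp_converges)
    ultimately show ?thesis
      using sums_unique2 by fastforce
  qed
  then show ?thesis
    by (simp add: vec_eq_iff)
qed

lemma transition_eigenvector:
  assumes "adj_matrix adj *v x = \<mu> *\<^sub>R x"
  shows "transition_matrix adj t *v cvec x = cis (t * \<mu>) *s cvec x"
proof -
  let ?M = "map_matrix (\<lambda>r. \<i> * of_real t * of_real r) (adj_matrix adj)"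
  have "(?M *v cvec x) $ i = \<i> * of_real t * of_real ((adj_matrix adj *v x) $ i)" for i
    by (simp add: matrix_vector_mult_def cvec_def map_matrix_def sum_distrib_left mult.assoc)
  then have "?M *v cvec x = (\<i> * of_real (t * \<mu>)) *s cvec x"
    by (simp add: vec_eq_iff assms cvec_def)
  then show ?thesis
    unfolding transition_matrix_def by (simp add: mat_exp_eigenvector cis_conv_exp)
qed

text \<open>This turns phases into signs: the factor between two proportional nonzero real vectors
  is real, and a real number of modulus one is 1 or -1.\<close>

lemma unimodular_ratio_real:
  fixes X Y :: "real^'v" and \<omega> \<gamma> :: complex
  assumes eq: "\<And>i. \<omega> * of_real (X $ i) = \<gamma> * of_real (Y $ i)"
    and "norm \<omega> = 1" "norm \<gamma> = 1"
  shows "Y = X \<or> Y = - X"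
proof (cases "X = 0")
  case True
  have "\<gamma> \<noteq> 0" using assms(3) by auto
  then have "Y $ i = 0" for i using eq[of i] True by simp
  then show ?thesis using True by (simp add: vec_eq_iff)
next
  case False
  then obtain j where j: "X $ j \<noteq> 0" by (auto simp: vec_eq_iff)
  have \<gamma>0: "\<gamma> \<noteq> 0" using assms(3) by auto
  define \<rho> where "\<rho> = \<omega> / \<gamma>"
  have Y: "of_real (Y $ i) = \<rho> * of_real (X $ i)" for i
    using eq[of i] \<gamma>0 by (simp add: \<rho>_def field_simps)
  have r: "\<rho> = of_real (Y $ j / X $ j)"
    using Y[of j] j by (simp add: field_simps)
  have "norm \<rho> = 1" using assms by (simp add: \<rho>_def norm_divide)
  with r have "\<bar>Y $ j / X $ j\<bar> = 1" by (metis norm_of_real)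
  with r have "\<rho> = 1 \<or> \<rho> = - 1" by (metis abs_if minus_minus of_real_1 of_real_minus)
  then show ?thesis
  proof
    assume "\<rho> = 1"
    then have "Y $ i = X $ i" for i using Y[of i] by simp
    then show ?thesis by (simp add: vec_eq_iff)
  next
    assume "\<rho> = - 1"
    then have "Y $ i = - X $ i" for i
      using Y[of i] by (metis mult_minus1 of_real_eq_iff of_real_minus)
    then show ?thesis by (simp add: vec_eq_iff)
  qed
qed

lemma symmetric_eigenvectors_orthogonal:
  fixes A :: "real^'v::finite^'v"
  assumes "transpose A = A" "A *v x = \<mu> *\<^sub>R x" "A *v y = \<nu> *\<^sub>R y" "\<mu> \<noteq> \<nu>"
  shows "x \<bullet> y = 0"
proof -
  have "\<mu> * (x \<bullet> y) = (A *v x) \<bullet> y" by (simp add: assms)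
  also have "\<dots> = x \<bullet> (A *v y)"
    by (metis assms(1) dot_lmul_matrix transpose_matrix_vector)
  also have "\<dots> = \<nu> * (x \<bullet> y)" by (simp add: assms)
  finally show ?thesis using assms(4) by simp
qed

text \<open>Cosine decreases strictly on [0, pi], so it does not reach -1 earlier. The minimum times
  rest on this bound.\<close>

lemma cis_eq_minus_one_imp_ge:
  assumes "cis (t * q) = - 1" "t > 0" "q > 0"
  shows "pi / q \<le> t"
proof (rule ccontr)
  assume "\<not> pi / q \<le> t"
  then have "t * q < pi" using assms by (simp add: field_simps)
  moreover have "cos (t * q) = - 1" using assms(1) by (simp add: complex_eq_iff)
  moreover have "cos pi < cos (t * q)"
    using calculation(1) assms by (intro cos_monotone_0_pi) auto
  ultimately show False by simp
qed

lemma cis_odd_multiple_pi: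
  "cis (pi * real j) = (- 1) ^ j"
  using Complex.DeMoivre[of pi j] by (simp add: mult.commute)

text \<open>The polynomial (X - b)(X - c) vanishes at two of the three nodes, so the matching
  combination of the three equations isolates one unknown. It serves to separate the three
  eigencomponents of a transfer.\<close>

lemma vandermonde3_kernel:
  fixes p q r :: complex
  assumes "p + q + r = 0" "l1 * p + l2 * q + l3 * r = 0" "l1\<^sup>2 * p + l2\<^sup>2 * q + l3\<^sup>2 * r = 0"
    and "l1 \<noteq> l2" "l1 \<noteq> l3" "l2 \<noteq> l3"
  shows "p = 0 \<and> q = 0 \<and> r = 0"
proof -
  have eval: "(a - b) * (a - c) * u = 0"
    if "u + v + w = 0" "a * u + b * v + c * w = 0" "a\<^sup>2 * u + b\<^sup>2 * v + c\<^sup>2 * w = 0"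
    for a b c u v w :: complex
  proof -
    have "(a - b) * (a - c) * u
        = (a\<^sup>2 * u + b\<^sup>2 * v + c\<^sup>2 * w) - (b + c) * (a * u + b * v + c * w) + b * c * (u + v + w)"
      by (simp add: power2_eq_square algebra_simps)
    then show ?thesis using that by simp
  qed
  have "(l1 - l2) * (l1 - l3) * p = 0" "(l2 - l1) * (l2 - l3) * q = 0"
    "(l3 - l1) * (l3 - l2) * r = 0"
    by (rule eval[of p q r] eval[of q p r] eval[of r p q]; use assms(1-3) in \<open>simp add: add_ac\<close>)+
  then show ?thesis using assms(4-6) by simp
qed

section \<open>Strongly regular graphs\<close>

locale connected_srg =
  fixes adj :: "'v::finite \<Rightarrow> 'v \<Rightarrow> bool" and n k a c :: nat
  assumes srg: "strongly_regular adj n k a c"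
    and connected: "connected_graph adj"
begin

lemma irrefl [simp]: "\<not> adj i i"
  and symm: "adj i j \<longleftrightarrow> adj j i"
  using srg by (auto simp: strongly_regular_def simple_graph_def)

lemma card_vertices: "CARD('v) = n"
  and k_ge: "2 \<le> k" and k_le: "k + 2 \<le> n"
  and degree: "card {j. adj i j} = k"
  and card_common_adj: "adj i j \<Longrightarrow> card {l. adj i l \<and> adj j l} = a"
  and card_common_nonadj: "nonadj adj i j \<Longrightarrow> card {l. adj i l \<and> adj j l} = c"
  using srg by (auto simp: strongly_regular_def common_nbrs_def)

lemma reachable_subset:
  assumes "i \<in> X" and "\<And>j l. j \<in> X \<Longrightarrow> adj j l \<Longrightarrow> l \<in> X"
  shows "X = UNIV"
proof -
  have "j \<in> X" for j
  proof -
    have "adj\<^sup>*\<^sup>* i j" using connected by (simp add: connected_graph_def)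
    then show ?thesis by (induction rule: rtranclp_induct) (use assms in auto)
  qed
  then show ?thesis by auto
qed

text \<open>The closed neighbourhood of i has at most k + 1 < n vertices, so by connectedness some
  edge leaves it. The induced path i, j, l yields the three parameter bounds that follow.\<close>

lemma closed_neighbourhood_not_closed:
  "\<exists>j l. adj i j \<and> adj j l \<and> \<not> adj i l \<and> i \<noteq> l"
proof (rule ccontr)
  assume "\<not> ?thesis"
  then have "insert i {j. adj i j} = UNIV"
    by (intro reachable_subset[of i]) auto
  moreover have "card (insert i {j. adj i j}) \<le> k + 1"
    using card_insert_le_m1[of "k + 1" "{j. adj i j}" i] degree[of i] by simp
  ultimately show False using card_vertices k_le by simp
qed

lemma c_pos: "0 < c"
proof -
  obtain i j l where "adj i j" "adj j l" "\<not> adj i l" "i \<noteq> l"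
    using closed_neighbourhood_not_closed by blast
  then have "nonadj adj i l" "j \<in> {q. adj i q \<and> adj l q}"
    by (auto simp: nonadj_def symm)
  then show ?thesis
    using card_common_nonadj[of i l] by (metis card_gt_0_iff empty_iff finite)
qed

lemma c_le: "c \<le> k"
proof -
  obtain i l where "nonadj adj i l"
    using closed_neighbourhood_not_closed unfolding nonadj_def by blast
  then have "c = card {q. adj i q \<and> adj l q}" by (simp add: card_common_nonadj)
  also have "\<dots> \<le> card {q. adj i q}" by (intro card_mono) auto
  finally show ?thesis by (simp add: degree)
qed

lemma a_le: "a + 2 \<le> k"
proof -
  obtain i j l where ij: "adj i j" and jl: "adj j l" "\<not> adj i l" "i \<noteq> l"
    using closed_neighbourhood_not_closed by blast
  \<comment> \<open>Both i and l are neighbours of j, and neither is a neighbour of i.\<close>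
  have "card {q. adj i q \<and> adj j q} \<le> card ({q. adj j q} - {i, l})"
    using jl by (intro card_mono) auto
  also have "\<dots> = k - 2"
    using ij jl symm by (subst card_Diff_subset) (auto simp: degree)
  finally have "a \<le> k - 2"
    using ij by (simp add: card_common_adj)
  then show ?thesis using k_ge by simp
qed

section \<open>Eigenvalues of the adjacency matrix\<close>

abbreviation "A \<equiv> adj_matrix adj"

text \<open>\<open>\<Theta>\<close> and \<open>\<Lambda>\<close> are the roots of X^2 = d X + (k -
  c), the equation satisfied by \<open>A\<close> on vectors whose entries sum to zero;
  \<open>D\<close> is their distance.\<close>

definition d :: real where "d = real a - real c"
definition D :: real where "D = sqrt (d\<^sup>2 + 4 * (real k - real c))"
definition \<Theta> :: real where "\<Theta> = (d + D) / 2"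
definition \<Lambda> :: real where "\<Lambda> = (d - D) / 2"

definition tot :: "real^'v \<Rightarrow> real" where "tot x = (\<Sum>i\<in>UNIV. x $ i)"

abbreviation ones :: "real^'v" where "ones \<equiv> 1"

lemma A_nth: "(A *v x) $ i = (\<Sum>j\<in>UNIV. of_bool (adj i j) * x $ j)"
  by (simp add: matrix_vector_mult_def adj_matrix_def of_bool_def)

lemma A_ev: "(A *v ev u) $ i = of_bool (adj i u)"
  by (simp add: A_nth axis_def if_distrib cong: if_cong)

lemma A_ones: "A *v ones = real k *\<^sub>R ones"
proof -
  have "(\<Sum>j\<in>UNIV. of_bool (adj i j)) = real k" for i
    using degree[of i] by simp
  then show ?thesis by (simp add: vec_eq_iff A_nth)
qed

lemma transpose_A: "transpose A = A"
  by (simp add: transpose_def adj_matrix_def vec_eq_iff symm)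

lemma tot_A: "tot (A *v x) = real k * tot x"
proof -
  have "tot (A *v x) = (\<Sum>j\<in>UNIV. \<Sum>i\<in>UNIV. of_bool (adj i j) * x $ j)"
    unfolding tot_def A_nth by (rule sum.swap)
  also have "\<dots> = (\<Sum>j\<in>UNIV. real k * x $ j)"
  proof (rule sum.cong)
    fix j
    have "(\<Sum>i\<in>UNIV. of_bool (adj i j)) = real k"
      using degree[of j] by (simp add: symm)
    then show "(\<Sum>i\<in>UNIV. of_bool (adj i j) * x $ j) = real k * x $ j"
      by (simp flip: sum_distrib_right)
  qed simp
  finally show ?thesis by (simp add: tot_def sum_distrib_left)
qed

text \<open>The walks of length two from i to l number k, a or c according to whether i = l, the two
  are adjacent, or neither: A^2 = (k - c) I + d A + c J.\<close>

lemma A_squared: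
  "A *v (A *v x) = (real k - real c) *\<^sub>R x + d *\<^sub>R (A *v x) + (real c * tot x) *\<^sub>R ones"
proof -
  have "(A *v (A *v x)) $ i
      = (real k - real c) * x $ i + d * (A *v x) $ i + real c * tot x" for i
  proof -
    have cn: "(\<Sum>j\<in>UNIV. of_bool (adj i j) * of_bool (adj j l))
        = (real k - real c) * of_bool (i = l) + d * of_bool (adj i l) + real c" for l
    proof -
      have "(\<Sum>j\<in>UNIV. of_bool (adj i j) * of_bool (adj j l))
          = real (card {j. adj i j \<and> adj l j})"
        by (simp add: symm flip: of_bool_conj)
      then show ?thesis
        using degree[of i] card_common_adj[of i l] card_common_nonadj[of i l]
        by (cases "i = l"; cases "adj i l") (auto simp: d_def nonadj_def)
    qed
    have "(A *v (A *v x)) $ i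
        = (\<Sum>j\<in>UNIV. \<Sum>l\<in>UNIV. of_bool (adj i j) * of_bool (adj j l) * x $ l)"
      unfolding A_nth[of "A *v x"] unfolding A_nth sum_distrib_left by (simp only: mult.assoc)
    also have "\<dots> = (\<Sum>l\<in>UNIV. (\<Sum>j\<in>UNIV. of_bool (adj i j) * of_bool (adj j l)) * x $ l)"
      by (subst sum.swap) (simp only: sum_distrib_right)
    also have "\<dots> = (\<Sum>l\<in>UNIV. (real k - real c) * (of_bool (i = l) * x $ l)
        + d * (of_bool (adj i l) * x $ l) + real c * x $ l)"
      by (simp only: cn distrib_right mult.assoc)
    also have "\<dots> = (real k - real c) * (\<Sum>l\<in>UNIV. of_bool (i = l) * x $ l)
        + d * (A *v x) $ i + real c * tot x"
      by (simp only: sum.distrib sum_distrib_left A_nth tot_def)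
    also have "(\<Sum>l\<in>UNIV. of_bool (i = l) * x $ l) = x $ i"
      by (simp add: of_bool_def if_distrib if_distribR cong: if_cong)
    finally show ?thesis .
  qed
  then show ?thesis by (simp add: vec_eq_iff)
qed

lemma tot_ones [simp]: "tot ones = real n"
  by (simp add: tot_def card_vertices)

lemma tot_linear [simp]:
  "tot (x + y) = tot x + tot y" "tot (x - y) = tot x - tot y"
  "tot (q *\<^sub>R x) = q * tot x" "tot (- x) = - tot x" "tot (ev u) = 1"
  by (simp_all add: tot_def sum.distrib sum_subtractf sum_distrib_left sum_negf axis_def)

text \<open>Both sides are entries of A^2 applied to the all-ones vector; this is the usual count k
  (k - a - 1) = (n - k - 1) c.\<close>

lemma parameter_identity: "(real k)\<^sup>2 = real k - real c + d * real k + real c * real n"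
proof -
  have "(A *v (A *v ones)) $ i = (real k)\<^sup>2" for i
    by (simp add: A_ones power2_eq_square matrix_vector_mult_scaleR)
  moreover have "(A *v (A *v ones)) $ i = real k - real c + d * real k + real c * real n" for i
    unfolding A_squared by (simp add: A_ones)
  ultimately show ?thesis by simp
qed

lemma n_pos: "0 < n" using k_ge k_le by simp

lemma D_squared: "D\<^sup>2 = d\<^sup>2 + 4 * (real k - real c)"
  using c_le by (simp add: D_def)

lemma D_pos: "0 < D"
proof -
  have "d\<^sup>2 + 4 * (real k - real c) > 0"
  proof (cases "c = k")
    case True
    then have "d < 0" using a_le unfolding d_def by simp
    then show ?thesis using True by simp
  next
    case False
    then have "c < k" using c_le by simp
    then show ?thesis by (simp add: add_nonneg_pos)
  qed
  then show ?thesis by (simp add: D_def)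
qed

lemma \<Theta>_\<Lambda>: "\<Theta> + \<Lambda> = d" "\<Theta> - \<Lambda> = D" "\<Theta> * \<Lambda> = real c - real k"
proof -
  have "\<Theta> * \<Lambda> = (d\<^sup>2 - D\<^sup>2) / 4"
    by (simp add: \<Theta>_def \<Lambda>_def power2_eq_square algebra_simps)
  then show "\<Theta> * \<Lambda> = real c - real k" by (simp add: D_squared)
qed (auto simp: \<Theta>_def \<Lambda>_def field_simps)

text \<open>The quadratic with roots \<open>\<Theta>\<close> and \<open>\<Lambda>\<close> is
  evaluated at k. Since c > 0 by connectedness, k is not one of its roots.\<close>

lemma eigenvalue_gap: "(real k - \<Theta>) * (real k - \<Lambda>) = real c * real n"
proof -
  have "(real k - \<Theta>) * (real k - \<Lambda>) = (real k)\<^sup>2 - (\<Theta> + \<Lambda>) * real k + \<Theta> * \<Lambda>"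
    by (simp add: power2_eq_square algebra_simps)
  then show ?thesis using parameter_identity by (simp add: \<Theta>_\<Lambda>)
qed

lemma eigenvalues_distinct: "real k \<noteq> \<Theta>" "real k \<noteq> \<Lambda>" "\<Theta> \<noteq> \<Lambda>"
  using eigenvalue_gap c_pos n_pos D_pos \<Theta>_\<Lambda>(2) by auto

section \<open>Eigencomponents of a vector\<close>

definition mean :: "real^'v \<Rightarrow> real" where "mean x = tot x / real n"
definition cent :: "real^'v \<Rightarrow> real^'v" where "cent x = x - mean x *\<^sub>R ones"
text \<open>\<open>X1\<close> and \<open>X2\<close> are the orthogonal projections to the
  eigenspaces of \<open>\<Theta>\<close> and \<open>\<Lambda>\<close> within the vectors of sum
  zero. A - \<Lambda> kills the second eigenspace and acts as D on the first, whence the factor 1 /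
  D.\<close>

definition X1 :: "real^'v \<Rightarrow> real^'v" where
  "X1 x = (1 / D) *\<^sub>R (A *v cent x - \<Lambda> *\<^sub>R cent x)"
definition X2 :: "real^'v \<Rightarrow> real^'v" where
  "X2 x = (1 / D) *\<^sub>R (\<Theta> *\<^sub>R cent x - A *v cent x)"

lemma tot_cent: "tot (cent x) = 0"
  using n_pos by (simp add: cent_def mean_def)

lemma A_cent_sq: "A *v (A *v cent x) = (\<Theta> + \<Lambda>) *\<^sub>R (A *v cent x) - (\<Theta> * \<Lambda>) *\<^sub>R cent x"
  unfolding A_squared tot_cent \<Theta>_\<Lambda> by (simp add: algebra_simps)

lemma A_X1: "A *v X1 x = \<Theta> *\<^sub>R X1 x"
proof -
  have "A *v (A *v cent x - \<Lambda> *\<^sub>R cent x) = \<Theta> *\<^sub>R (A *v cent x - \<Lambda> *\<^sub>R cent x)"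
    by (simp add: matrix_vector_mult_diff_distrib matrix_vector_mult_scaleR A_cent_sq algebra_simps)
  then show ?thesis by (simp add: X1_def matrix_vector_mult_scaleR)
qed

lemma A_X2: "A *v X2 x = \<Lambda> *\<^sub>R X2 x"
proof -
  have "A *v (\<Theta> *\<^sub>R cent x - A *v cent x) = \<Lambda> *\<^sub>R (\<Theta> *\<^sub>R cent x - A *v cent x)"
    by (simp add: matrix_vector_mult_diff_distrib matrix_vector_mult_scaleR A_cent_sq algebra_simps)
  then show ?thesis by (simp add: X2_def matrix_vector_mult_scaleR)
qed

lemma X1_plus_X2: "X1 x + X2 x = cent x"
proof -
  have "X1 x + X2 x = (1 / D) *\<^sub>R ((\<Theta> - \<Lambda>) *\<^sub>R cent x)"
    unfolding X1_def X2_def by (simp add: algebra_simps)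
  then show ?thesis using D_pos by (simp add: \<Theta>_\<Lambda>)
qed

lemma decomposition: "x = mean x *\<^sub>R ones + X1 x + X2 x"
  using X1_plus_X2[of x] by (simp add: cent_def algebra_simps)

lemma A_cmean: "A *v (q *\<^sub>R ones) = real k *\<^sub>R (q *\<^sub>R ones)"
  by (simp add: matrix_vector_mult_scaleR A_ones)

lemma norm_decomposition:
  "(norm x)\<^sup>2 = (mean x)\<^sup>2 * real n + (norm (X1 x))\<^sup>2 + (norm (X2 x))\<^sup>2"
proof -
  let ?m = "mean x *\<^sub>R ones"
  note orth = symmetric_eigenvectors_orthogonal[OF transpose_A]
  have o: "?m \<bullet> X1 x = 0" "?m \<bullet> X2 x = 0" "X1 x \<bullet> X2 x = 0"
    using orth[OF A_cmean A_X1] orth[OF A_cmean A_X2] orth[OF A_X1 A_X2] eigenvalues_distinct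
    by blast+
  have "(norm x)\<^sup>2 = (?m + X1 x + X2 x) \<bullet> (?m + X1 x + X2 x)"
    using decomposition[of x] by (metis power2_norm_eq_inner)
  also have "\<dots> = ?m \<bullet> ?m + X1 x \<bullet> X1 x + X2 x \<bullet> X2 x"
    using o by (auto simp: inner_add_left inner_add_right inner_commute)
  also have "?m \<bullet> ?m = (mean x)\<^sup>2 * real n"
    by (simp add: inner_vec_def card_vertices power2_eq_square)
  finally show ?thesis by (simp add: power2_norm_eq_inner)
qed

section \<open>Transfer as a condition on each eigencomponent\<close>

lemma cvec_linear: "cvec (x + y) = cvec x + cvec y" "cvec (q *\<^sub>R x) = of_real q *s cvec x"
  by (simp_all add: cvec_def vec_eq_iff)

lemma transition_decomposition:
  "(transition_matrix adj t *v cvec x) $ i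
    = cis (t * real k) * of_real (mean x) + cis (t * \<Theta>) * of_real (X1 x $ i)
      + cis (t * \<Lambda>) * of_real (X2 x $ i)"
proof -
  have "transition_matrix adj t *v cvec x = transition_matrix adj t *v cvec (mean x *\<^sub>R ones)
      + transition_matrix adj t *v cvec (X1 x) + transition_matrix adj t *v cvec (X2 x)"
    by (subst decomposition) (simp only: cvec_linear(1) matrix_vector_right_distrib)
  also have "\<dots> = cis (t * real k) *s cvec (mean x *\<^sub>R ones) + cis (t * \<Theta>) *s cvec (X1 x)
      + cis (t * \<Lambda>) *s cvec (X2 x)"
    by (simp only: transition_eigenvector[OF A_cmean] transition_eigenvector[OF A_X1]
        transition_eigenvector[OF A_X2])
  finally show ?thesis by (simp add: cvec_def)
qed

definition phases :: "complex \<Rightarrow> real^'v \<Rightarrow> real^'v \<Rightarrow> real \<Rightarrow> bool" where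
  "phases \<gamma> x y t \<longleftrightarrow>
     cis (t * real k) * of_real (mean x) = \<gamma> * of_real (mean y) \<and>
     (\<forall>i. cis (t * \<Theta>) * of_real (X1 x $ i) = \<gamma> * of_real (X1 y $ i)) \<and>
     (\<forall>i. cis (t * \<Lambda>) * of_real (X2 x $ i) = \<gamma> * of_real (X2 y $ i))"

lemma A_cvec_components: "(\<Sum>j\<in>UNIV. of_bool (adj i j) * complex_of_real (x $ j)) =
    of_real ((A *v x) $ i)"
  by (simp add: A_nth)

text \<open>The differences p, q, r of the two sides in the three components add up to zero.
  Applying \<open>A\<close> once and twice multiplies them by the eigenvalues and by their squares,
  so the Vandermonde argument makes each of them vanish.\<close>

lemma pst_at_iff_phases: "pst_at adj x y t \<longleftrightarrow> t > 0 \<and> (\<exists>\<gamma>. phases \<gamma> x y t)"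
proof -
  have "transition_matrix adj t *v cvec x = \<gamma> *s cvec y \<longleftrightarrow> phases \<gamma> x y t" for \<gamma>
  proof
    assume eq: "transition_matrix adj t *v cvec x = \<gamma> *s cvec y"
    define p where "p i = cis (t * real k) * of_real (mean x) - \<gamma> * of_real (mean y)" for i :: 'v
    define q where "q i = cis (t * \<Theta>) * of_real (X1 x $ i) - \<gamma> * of_real (X1 y $ i)" for i
    define r where "r i = cis (t * \<Lambda>) * of_real (X2 x $ i) - \<gamma> * of_real (X2 y $ i)" for i
    have y: "y $ i = mean y + X1 y $ i + X2 y $ i" for i
      using arg_cong[OF decomposition[of y], of "\<lambda>v. v $ i"] by simp
    have s0: "p i + q i + r i = 0" for i
    proof -
      have "(transition_matrix adj t *v cvec x) $ i = \<gamma> * of_real (y $ i)"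
        unfolding eq by (simp add: cvec_def)
      then show ?thesis
        unfolding transition_decomposition y[of i] p_def q_def r_def by (simp add: algebra_simps)
    qed
    \<comment> \<open>\<open>?S\<close> is multiplication by \<open>A\<close> on complex-valued
      functions of the vertices.\<close>
    let ?S = "\<lambda>f i. \<Sum>j\<in>UNIV. of_bool (adj i j) * (f j :: complex)"
    have Sp: "?S p i = of_real (real k) * p i" for i
    proof -
      have "(\<Sum>j\<in>UNIV. of_bool (adj i j) :: complex) = of_nat k"
        using degree[of i] by simp
      then show ?thesis by (simp add: p_def flip: sum_distrib_right)
    qed
    have Sq: "?S q i = of_real \<Theta> * q i" for i
    proof -
      have "?S q i = cis (t * \<Theta>) * (\<Sum>j\<in>UNIV. of_bool (adj i j) * of_real (X1 x $ j))
          - \<gamma> * (\<Sum>j\<in>UNIV. of_bool (adj i j) * of_real (X1 y $ j))"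
        unfolding q_def right_diff_distrib sum_subtractf sum_distrib_left
        by (simp only: mult.left_commute)
      then show ?thesis
        unfolding A_cvec_components A_X1 by (simp add: q_def algebra_simps)
    qed
    have Sr: "?S r i = of_real \<Lambda> * r i" for i
    proof -
      have "?S r i = cis (t * \<Lambda>) * (\<Sum>j\<in>UNIV. of_bool (adj i j) * of_real (X2 x $ j))
          - \<gamma> * (\<Sum>j\<in>UNIV. of_bool (adj i j) * of_real (X2 y $ j))"
        unfolding r_def right_diff_distrib sum_subtractf sum_distrib_left
        by (simp only: mult.left_commute)
      then show ?thesis
        unfolding A_cvec_components A_X2 by (simp add: r_def algebra_simps)
    qed
    have s1: "of_real (real k) * p i + of_real \<Theta> * q i + of_real \<Lambda> * r i = 0" for i
    proof -
      have "?S p i + ?S q i + ?S r i = ?S (\<lambda>j. p j + q j + r j) i"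
        by (simp add: sum.distrib algebra_simps)
      also have "\<dots> = 0" by (simp only: s0) simp
      finally show ?thesis by (simp only: Sp Sq Sr)
    qed
    have s2: "(of_real (real k))\<^sup>2 * p i + (of_real \<Theta>)\<^sup>2 * q i + (of_real \<Lambda>)\<^sup>2 * r i = 0" for i
    proof -
      have "of_real (real k) * ?S p i + of_real \<Theta> * ?S q i + of_real \<Lambda> * ?S r i
          = ?S (\<lambda>j. of_real (real k) * p j + of_real \<Theta> * q j + of_real \<Lambda> * r j) i"
        unfolding distrib_left sum.distrib sum_distrib_left by (simp only: mult.left_commute)
      also have "\<dots> = 0" by (simp only: s1) simp
      finally show ?thesis by (simp only: Sp Sq Sr power2_eq_square mult.assoc)
    qed
    have "p i = 0 \<and> q i = 0 \<and> r i = 0" for i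
      by (rule vandermonde3_kernel[OF s0 s1 s2])
        (use eigenvalues_distinct in \<open>simp_all only: of_real_eq_iff not_False_eq_True\<close>)
    then show "phases \<gamma> x y t" by (simp add: phases_def p_def q_def r_def)
  next
    assume ph: "phases \<gamma> x y t"
    have "y $ i = mean y + X1 y $ i + X2 y $ i" for i
      using arg_cong[OF decomposition[of y], of "\<lambda>v. v $ i"] by simp
    then have "(transition_matrix adj t *v cvec x) $ i = (\<gamma> *s cvec y) $ i" for i
      using ph unfolding transition_decomposition phases_def by (simp add: cvec_def algebra_simps)
    then show "transition_matrix adj t *v cvec x = \<gamma> *s cvec y" by (simp add: vec_eq_iff)
  qed
  then show ?thesis by (simp add: pst_at_def)
qed

text \<open>Each component of x has |\<gamma>| times the norm of the matching component of y, so
  Pythagoras gives norm x = |\<gamma>| norm y. This takes the place of unitarity of the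
  walk.\<close>

lemma phases_unimodular:
  assumes ph: "phases \<gamma> x y t" and "norm x = norm y" "x \<noteq> 0"
  shows "norm \<gamma> = 1"
proof -
  have m: "\<bar>mean x\<bar> = norm \<gamma> * \<bar>mean y\<bar>"
    using ph unfolding phases_def
    by (metis norm_cis norm_mult norm_of_real mult_1)
  have X: "norm X = norm \<gamma> * norm Y"
    if "\<And>i. \<omega> * of_real (X $ i) = \<gamma> * of_real (Y $ i)" "norm \<omega> = 1"
    for X Y :: "real^'v" and \<omega>
  proof -
    have "\<bar>X $ i\<bar> = norm \<gamma> * \<bar>Y $ i\<bar>" for i
      using arg_cong[OF that(1)[of i], of norm] that(2) by (simp add: norm_mult)
    then have "norm X = L2_set (\<lambda>i. norm \<gamma> * \<bar>Y $ i\<bar>) UNIV" by (simp add: norm_vec_def)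
    then show ?thesis by (simp add: norm_vec_def L2_set_right_distrib)
  qed
  have "norm (X1 x) = norm \<gamma> * norm (X1 y)" "norm (X2 x) = norm \<gamma> * norm (X2 y)"
    using ph by (auto simp: phases_def intro!: X)
  then have "(norm x)\<^sup>2 = (norm \<gamma>)\<^sup>2 * (norm y)\<^sup>2"
    using arg_cong[OF m, of "\<lambda>r. r\<^sup>2"] norm_decomposition[of x] norm_decomposition[of y]
    by (simp add: power_mult_distrib algebra_simps)
  moreover have "y \<noteq> 0" using assms(2,3) by auto
  ultimately have "(norm \<gamma>)\<^sup>2 = 1" using assms(2,3) by simp
  then show ?thesis by (simp add: power2_eq_1_iff) (smt (verit) norm_ge_zero)
qed

lemma phases_signs:
  assumes ph: "phases \<gamma> x y t" and "norm x = norm y" "x \<noteq> 0"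
  shows "X1 y = X1 x \<or> X1 y = - X1 x" "X2 y = X2 x \<or> X2 y = - X2 x"
  using ph phases_unimodular[OF assms] unfolding phases_def
  by (meson norm_cis unimodular_ratio_real)+


section \<open>Signs and the adjacency equation\<close>

text \<open>On vectors of sum zero 2 A - d acts as D at \<open>\<Theta>\<close> and as -D at
  \<open>\<Lambda>\<close>. Flipping exactly one component is therefore an affine condition on A x;
  undoing the centring produces the constant term.\<close>

lemma reflection_equation:
  assumes "cent y = \<sigma> *\<^sub>R (X1 x - X2 x)" "mean y = mean x" "\<sigma> = 1 \<or> \<sigma> = - 1"
  shows "2 * (A *v x) $ i = d * x $ i + \<sigma> * D * y $ i + (2 * real k - d - \<sigma> * D) * mean x"
proof -
  have "D *\<^sub>R (X1 x - X2 x) = 2 *\<^sub>R (A *v cent x) - (\<Theta> + \<Lambda>) *\<^sub>R cent x"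
    using D_pos by (simp add: X1_def X2_def scaleR_diff_right algebra_simps scaleR_2)
  moreover have "D *\<^sub>R (X1 x - X2 x) = (\<sigma> * D) *\<^sub>R cent y"
    using assms(1,3) by auto
  ultimately have "(\<sigma> * D) *\<^sub>R cent y = 2 *\<^sub>R (A *v cent x) - d *\<^sub>R cent x"
    by (simp add: \<Theta>_\<Lambda>)
  then have "((\<sigma> * D) *\<^sub>R cent y) $ i = (2 *\<^sub>R (A *v cent x) - d *\<^sub>R cent x) $ i" by simp
  moreover have "A *v cent x = A *v x - (real k * mean x) *\<^sub>R ones"
    unfolding cent_def by (simp add: matrix_vector_mult_diff_distrib matrix_vector_mult_scaleR A_ones)
  ultimately show ?thesis
    using assms(2) by (simp add: cent_def A_ones algebra_simps)
qed

text \<open>No flip means y = x and two flips give the reflection of x in its mean;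
  \<open>e = D\<close> is the flip at \<open>\<Lambda>\<close>, \<open>e = - D\<close> the flip at
  \<open>\<Theta>\<close>. A flip is an involution, so the equation also holds with x and y
  exchanged, which brings in the adjacencies to w and z.\<close>

lemma transfer_equation:
  assumes "phases \<gamma> x y t" "norm x = norm y" "x \<noteq> 0" "tot y = tot x" "y \<noteq> x"
  shows "y = (2 * mean x) *\<^sub>R ones - x \<or>
    (\<exists>e. (e = D \<or> e = - D) \<and>
      (\<forall>i. 2 * (A *v x) $ i = d * x $ i + e * y $ i + (2 * real k - d - e) * mean x) \<and>
      (\<forall>i. 2 * (A *v y) $ i = d * y $ i + e * x $ i + (2 * real k - d - e) * mean x))"
proof -
  have m: "mean y = mean x" using assms(4) by (simp add: mean_def)
  have y: "cent y = X1 y + X2 y" "cent x = X1 x + X2 x" by (simp_all add: X1_plus_X2)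
  consider "X1 y = X1 x" "X2 y = X2 x" | "X1 y = - X1 x" "X2 y = - X2 x"
    | "X1 y = X1 x" "X2 y = - X2 x" | "X1 y = - X1 x" "X2 y = X2 x"
    using phases_signs[OF assms(1-3)] by blast
  then show ?thesis
  proof cases
    case 1
    then have "cent y = cent x" using y by simp
    then show ?thesis using m assms(5) by (simp add: cent_def)
  next
    case 2
    then have "cent y = - cent x" using y by simp
    then show ?thesis using m by (simp add: cent_def algebra_simps flip: scaleR_add_left)
  next
    case 3
    then have "cent y = 1 *\<^sub>R (X1 x - X2 x)" "cent x = 1 *\<^sub>R (X1 y - X2 y)" using y by simp_all
    then show ?thesis
      using reflection_equation[of y 1 x] reflection_equation[of x 1 y] m
      by (intro disjI2 exI[of _ D]) simp
  next
    case 4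
    then have "cent y = (- 1) *\<^sub>R (X1 x - X2 x)" "cent x = (- 1) *\<^sub>R (X1 y - X2 y)"
      using y by simp_all
    then show ?thesis
      using reflection_equation[of y "- 1" x] reflection_equation[of x "- 1" y] m
      by (intro disjI2 exI[of _ "- D"]) simp
  qed
qed

text \<open>Equality amounts to k = a + 1, against a + 2 \<le> k. It excludes e = d + 2, the rival
  of e = d in several overlap patterns.\<close>

lemma shift_ne: "D\<^sup>2 \<noteq> (d + 2)\<^sup>2"
proof
  assume "D\<^sup>2 = (d + 2)\<^sup>2"
  then have "d + 1 = real k - real c"
    unfolding D_squared by (simp add: power2_eq_square algebra_simps)
  then show False using a_le by (simp add: d_def)
qed

text \<open>Two distinct nonadjacent vertices have k common neighbours, which is the whole
  neighbourhood of each. Nonadjacency thus becomes an equivalence relation.\<close>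

lemma nonadj_same_nbrs:
  assumes "c = k" "\<not> adj i j"
  shows "adj i l \<longleftrightarrow> adj j l"
proof (cases "i = j")
  case False
  then have "card {q. adj i q \<and> adj j q} = k"
    using assms card_common_nonadj[of i j] by (simp add: nonadj_def)
  then have "{q. adj i q \<and> adj j q} = {q. adj i q}" "{q. adj i q \<and> adj j q} = {q. adj j q}"
    using card_subset_eq[of "{q. adj i q}"] card_subset_eq[of "{q. adj j q}"] degree
    by (metis (no_types, lifting) finite mem_Collect_eq subsetI)+
  then show ?thesis by blast
qed simp

lemma nonadj_not_adj_exactly_one:
  assumes "c = k" "\<not> adj u v" "of_bool (adj i u) + of_bool (adj i v) = (1 :: real)"
  shows False
  using nonadj_same_nbrs[OF assms(1,2), of i] assms(3) symm by auto

text \<open>In the lemmas below, \<open>e = d\<close> amounts to \<open>c = k\<close> together with the statement that it is the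
  component at the eigenvalue \<open>0\<close> whose sign flips.\<close>

definition adjacency_equation ::
  "real \<Rightarrow> real \<Rightarrow> 'v \<Rightarrow> 'v \<Rightarrow> 'v \<Rightarrow> 'v \<Rightarrow> real \<Rightarrow> bool" where
  "adjacency_equation e \<beta> u v w z s \<longleftrightarrow>
    (\<forall>i. 2 * (of_bool (adj i u) + s * of_bool (adj i v))
      = d * (of_bool (i = u) + s * of_bool (i = v)) + e * (of_bool (i = w) + s * of_bool (i = z)) + \<beta>)"

lemma adjacency_equationD:
  assumes "adjacency_equation e \<beta> u v w z s"
  shows "2 * (of_bool (adj i u) + s * of_bool (adj i v))
      = d * (of_bool (i = u) + s * of_bool (i = v)) + e * (of_bool (i = w) + s * of_bool (i = z)) + \<beta>"
  using assms by (simp add: adjacency_equation_def)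

text \<open>The states share the vertex v, with weight s in one and 1 in the other. Comparing the
  first equation at v with the second at u leaves only d = 0 and d = -2, and the entries at u, v and
  z refute both.\<close>

lemma shared_second_first_impossible:
  assumes E: "adjacency_equation e \<beta> u v v z s" "adjacency_equation e \<beta> v z u v s"
    and "e \<noteq> 0" "\<beta> \<noteq> 0" "s \<noteq> 0" "u \<noteq> v" "v \<noteq> z" "u \<noteq> z"
  shows False
proof -
  note E1 = adjacency_equationD[OF E(1)] and E2 = adjacency_equationD[OF E(2)]
  let ?uv = "of_bool (adj u v) :: real" and ?vz = "of_bool (adj v z) :: real"
    and ?uz = "of_bool (adj u z) :: real"
  have eqs: "2 * (s * ?uv) = d + \<beta>" "2 * ?uv = d * s + e + \<beta>"
    "2 * (?uv + s * ?uz) = e + \<beta>" "2 * ?vz = d * s + \<beta>"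
    using E1[of u] E1[of v] E2[of v] E2[of z] E2[of u] assms(6-8) symm[of u v] symm[of u z] symm[of v z]
    by auto
  have "s * (d + 2 * ?uz) = 0" using eqs(2,3) by (simp add: algebra_simps)
  then have d: "d = - 2 * ?uz" using assms(5) by simp
  show False
  proof (cases "adj u z")
    case True
    then have "d = - 2" using d by simp
    then show False
      using eqs assms(3-5) True by (cases "adj u v"; cases "adj v z"; simp)
  next
    case False
    then have "d = 0" using d by simp
    then show False
      using eqs assms(3-5) False by (cases "adj u v"; cases "adj v z"; simp)
  qed
qed

lemma e_eq_d_or_shift:
  assumes "e\<^sup>2 = D\<^sup>2" "2 * of_bool b = e - d"
  shows "e = d"
  using assms shift_ne by (cases b) (auto simp: algebra_simps)

text \<open>As s \<noteq> 1, the entries at u and v force u v to be an edge with d = -2 and \<beta>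
  = 2 + 2s. Every vertex outside the four is then adjacent to both u and v, so only the adjacencies
  between {u, v} and {w, z} remain to be decided.\<close>

lemma disjoint_unequal_weights:
  assumes E: "adjacency_equation e \<beta> u v w z s" "adjacency_equation e \<beta> w z u v s"
    and "\<beta> \<noteq> 0" "s \<noteq> 0" "s \<noteq> 1" "distinct [u, v, w, z]" "e \<noteq> 0"
  shows "e = d"
proof -
  note E1 = adjacency_equationD[OF E(1)] and E2 = adjacency_equationD[OF E(2)]
  have dist: "u \<noteq> v" "u \<noteq> w" "u \<noteq> z" "v \<noteq> w" "v \<noteq> z" "w \<noteq> z" using assms(6) by auto
  have eu: "2 * s * of_bool (adj u v) = d + \<beta>" and ev: "2 * of_bool (adj u v) = d * s + \<beta>"
    using E1[of u] E1[of v] dist symm[of u v] by auto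
  have "(s - 1) * (2 * of_bool (adj u v) + d) = 0" using eu ev by (simp add: algebra_simps)
  then have d: "d = - 2 * of_bool (adj u v)" using assms(5) by simp
  have uv: "adj u v" and d2: "d = - 2" and \<beta>: "\<beta> = 2 + 2 * s"
    using d eu assms(3) by (cases "adj u v"; simp)+
  have s1: "s \<noteq> - 1" using \<beta> assms(3) by auto
  have out: "adj i u \<and> adj i v" if "i \<notin> {u, v, w, z}" for i
    using E1[of i] that \<beta> assms(4,5) s1 by (cases "adj i u"; cases "adj i v") auto
  have ew: "2 * (of_bool (adj w u) + s * of_bool (adj w v)) = e + \<beta>"
    and ez: "2 * (of_bool (adj z u) + s * of_bool (adj z v)) = e * s + \<beta>"
    and eu': "2 * (of_bool (adj w u) + s * of_bool (adj z u)) = e + \<beta>"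
    using E1[of w] E1[of z] E2[of u] dist symm[of w u] symm[of z u] by auto
  have wz: "adj w v = adj z u"
    using ew eu' assms(4) by (cases "adj w v"; cases "adj z u") auto
  show ?thesis
  proof (cases "adj z u")
    case True
    then show ?thesis
      using ew wz \<beta> d2 assms(7) by (cases "adj w u") auto
  next
    case False
    have "adj w u = adj z v"
    proof (rule ccontr)
      assume ne: "adj w u \<noteq> adj z v"
      have out': "adj u j \<and> adj v j" if "j \<notin> {u, v, w, z}" for j
        using out[OF that] symm[of u j] symm[of v j] by simp
      \<comment> \<open>Beyond the four vertices u and v have the same neighbours, so a single edge
        among w u and z v would give them different degrees.\<close>
      have "{j. adj u j} - {v} \<subset> {j. adj v j} - {u} \<or> {j. adj v j} - {u} \<subset> {j. adj u j} - {v}"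
      proof (cases "adj w u")
        case True
        then have "\<not> adj v w" "\<not> adj v z" "adj u w"
          using ne False wz symm[of v w] symm[of v z] symm[of u w] by auto
        then have nz: "j \<notin> {u, v, w, z}" if "adj v j" "j \<noteq> u" for j
          using that dist by auto
        have "{j. adj v j} - {u} \<subseteq> {j. adj u j} - {v}"
          using nz out' by blast
        then show ?thesis
          using \<open>adj u w\<close> \<open>\<not> adj v w\<close> dist by blast
      next
        case not_wu: False
        then have "\<not> adj u w" "\<not> adj u z" "adj v z"
          using ne False symm[of u w] symm[of v z] symm[of u z] by auto
        then have nz: "j \<notin> {u, v, w, z}" if "adj u j" "j \<noteq> v" for j
          using that dist by auto
        have "{j. adj u j} - {v} \<subseteq> {j. adj v j} - {u}"
          using nz out' by blast
        then show ?thesis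
          using \<open>adj v z\<close> \<open>\<not> adj u z\<close> dist by blast
      qed
      then have "card ({j. adj u j} - {v}) \<noteq> card ({j. adj v j} - {u})"
        by (metis finite less_irrefl psubset_card_mono)
      then show False
        using uv symm[of u v] by (simp add: degree)
    qed
    then have "2 * of_bool (adj w u) = e + 2 + 2 * s" "2 * s * of_bool (adj w u) = e * s + 2 + 2 * s"
      using ew ez wz False \<beta> by auto
    then have "(s - 1) * (s + 1) = 0" by (simp add: algebra_simps)
    then show ?thesis using assms(5) s1 by simp
  qed
qed

text \<open>As n \<noteq> 4, there is a vertex i outside the four; it makes \<beta> twice the number
  of its neighbours among u and v, hence 2 or 4. The entries at u and w then leave finitely many
  pairs (d, e).\<close>

lemma disjoint_equal_weights:
  assumes E: "adjacency_equation e \<beta> u v w z 1"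
    and e: "e\<^sup>2 = D\<^sup>2" and "\<beta> \<noteq> 0" "distinct [u, v, w, z]" "n \<noteq> 4"
  shows "e = d"
proof -
  note E1 = adjacency_equationD[OF E(1)]
  have dist: "u \<noteq> v" "u \<noteq> w" "u \<noteq> z" "v \<noteq> w" "v \<noteq> z" "w \<noteq> z" using assms(4) by auto
  have "card {u, v, w, z} = 4" using dist by simp
  then have "{u, v, w, z} \<noteq> UNIV" using assms(5) card_vertices by auto
  then obtain i where i: "i \<notin> {u, v, w, z}" by blast
  have \<beta>i: "2 * (of_bool (adj j u) + of_bool (adj j v)) = \<beta>" if "j \<notin> {u, v, w, z}" for j
    using E1[of j] that by auto
  have \<beta>: "\<beta> = 4 \<or> \<beta> = 2" using \<beta>i[OF i] assms(3) by (cases "adj i u"; cases "adj i v") auto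
  have d: "d = 2 * of_bool (adj u v) - \<beta>" using E1[of u] dist by auto
  have ew: "2 * (of_bool (adj w u) + of_bool (adj w v)) = e + \<beta>"
    and ez: "2 * (of_bool (adj z u) + of_bool (adj z v)) = e + \<beta>"
    using E1[of w] E1[of z] dist by auto
  have e0: "e \<noteq> 0" using e D_pos by auto
  have e2: "e\<^sup>2 = d\<^sup>2 + 4 * (real k - real c)" using e D_squared by simp
  from \<beta> show ?thesis
  proof
    assume \<beta>4: "\<beta> = 4"
    have "e = - 4 \<or> e = - 2" using ew e0 \<beta>4 by (cases "adj w u"; cases "adj w v") auto
    then show ?thesis
    proof
      assume e4: "e = - 4"
      have "\<not> adj u v"
      proof
        assume uv: "adj u v"
        \<comment> \<open>Here w and z are not adjacent to u, and all vertices outside the four are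
          adjacent to both u and v. An edge u v would have k - 1 common neighbours.\<close>
        have "{j. adj u j} - {v} \<subseteq> {j. adj u j \<and> adj v j}"
        proof (rule subsetI, unfold mem_Collect_eq)
          fix j assume "j \<in> {j. adj u j} - {v}"
          then have j: "adj u j" "j \<noteq> v" "j \<noteq> u" by auto
          have "\<not> adj w u" using ew e4 \<beta>4 by (cases "adj w u"; cases "adj w v") auto
          moreover have "\<not> adj z u" using ez e4 \<beta>4 by (cases "adj z u"; cases "adj z v") auto
          ultimately have "j \<notin> {u, v, w, z}" using j symm[of u w] symm[of u z] by auto
          then have "adj j v" using \<beta>i[of j] \<beta>4 by (cases "adj j u"; cases "adj j v") auto
          then show "adj u j \<and> adj v j" using j symm[of v j] by simp
        qed
        then have "card ({j. adj u j} - {v}) \<le> card {j. adj u j \<and> adj v j}"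
          by (intro card_mono) auto
        then show False using uv degree[of u] card_common_adj[OF uv] a_le by simp
      qed
      then show ?thesis using d \<beta>4 e4 by simp
    next
      assume e2': "e = - 2"
      \<comment> \<open>Otherwise D^2 = 4 would be smaller than d^2 = 16.\<close>
      then have "d \<noteq> - 4" using e2 c_le by auto
      then show ?thesis using d \<beta>4 e2' by (cases "adj u v") auto
    qed
  next
    assume \<beta>2: "\<beta> = 2"
    have "e = 2 \<or> e = - 2" using ew e0 \<beta>2 by (cases "adj w u"; cases "adj w v") auto
    then have e4: "e\<^sup>2 = 4" by auto
    show ?thesis
    proof (cases "adj u v")
      case True
      then have "d = 0" using d \<beta>2 by simp
      then show ?thesis using e4 e shift_ne by simp
    next
      case False
      then have "d = - 2" using d \<beta>2 by simp
      then have "c = k" using e2 e4 by simp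
      then show ?thesis
        using nonadj_not_adj_exactly_one[of u v i] False \<beta>i[OF i] \<beta>2 by simp
    qed
  qed
qed

text \<open>The cases are the overlap patterns of the ordered pairs (u, v) and (w, z). The
  configuration with n = 4 is set aside because on the 4-cycle, with u and v nonadjacent, e = D
  holds while d = - D.\<close>

lemma adjacency_equation_imp_e_eq_d:
  assumes E: "adjacency_equation e \<beta> u v w z s" "adjacency_equation e \<beta> w z u v s"
    and e: "e\<^sup>2 = D\<^sup>2" and "\<beta> \<noteq> 0" "s \<noteq> 0" "u \<noteq> v" "w \<noteq> z"
    and ne: "\<not> (w = u \<and> z = v)" "\<not> (s = 1 \<and> w = v \<and> z = u)"
    and n4: "\<not> (n = 4 \<and> s = 1 \<and> distinct [u, v, w, z])"
  shows "e = d"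
proof -
  note E1 = adjacency_equationD[OF E(1)] and E2 = adjacency_equationD[OF E(2)]
  have e0: "e \<noteq> 0" using e D_pos by auto
  consider "distinct [u, v, w, z]" | "w = u" "z \<notin> {u, v}" | "w = v" "z \<notin> {u, v}"
    | "z = u" "w \<notin> {u, v}" | "z = v" "w \<notin> {u, v}" | "w = v" "z = u"
    using assms(6,7) ne(1) by auto
  then show ?thesis
  proof cases
    case 1
    then show ?thesis
      using disjoint_unequal_weights[OF E] disjoint_equal_weights[of e \<beta> u v w z] E e e0 assms(4,5) n4
      by (cases "s = 1") auto
  next
    case 2
    \<comment> \<open>The shared vertex u has the same right side in both equations. The remaining
      entries then differ by a multiple of e - d.\<close>
    have "of_bool (adj u z) = (of_bool (adj u v) :: real)"
      using E1[of u] E2[of u] 2 assms(5,6) by (cases "adj u z"; cases "adj u v") auto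
    then have "2 * s * of_bool (adj z v) = (e - d) * s"
      using E1[of z] E1[of v] 2 assms(5,6) symm[of u z] symm[of u v] by (auto simp: algebra_simps)
    then have "2 * of_bool (adj z v) = e - d" using assms(5) by simp
    then show ?thesis by (rule e_eq_d_or_shift[OF e])
  next
    case 3
    then show ?thesis
      using shared_second_first_impossible[of e \<beta> u v z s] E e0 assms(4-6) by auto
  next
    case 4
    then show ?thesis
      using shared_second_first_impossible[of e \<beta> w u v s] E e0 assms(4-6) by auto
  next
    case 5
    have "of_bool (adj v w) = (of_bool (adj u v) :: real)"
      using E1[of v] E2[of v] 5 assms(5,6) symm[of u v] by (cases "adj v w"; cases "adj u v") auto
    then have "2 * of_bool (adj w u) = e - d"
      using E1[of w] E1[of u] 5 assms(5,6) symm[of v w] by (auto simp: algebra_simps)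
    then show ?thesis by (rule e_eq_d_or_shift[OF e])
  next
    case 6
    have "2 * s * of_bool (adj u v) = d + e * s + \<beta>" "2 * of_bool (adj u v) = d * s + e + \<beta>"
      using E1[of u] E1[of v] 6 assms(6) symm[of u v] by auto
    then have "(s - 1) * (2 * of_bool (adj u v) - (e - d)) = 0" by (simp add: algebra_simps)
    then have "2 * of_bool (adj u v) = e - d" using ne(2) 6 by simp
    then show ?thesis by (rule e_eq_d_or_shift[OF e])
  qed
qed

lemma d_complete_multipartite: "c = k \<Longrightarrow> d = - (real n - real k)"
proof -
  assume "c = k"
  then have "real k * real k = real k * (d + real n)"
    using parameter_identity by (simp add: power2_eq_square algebra_simps)
  then show ?thesis using k_ge by simp
qed

text \<open>A vertex of one state outside the other gives e = 2 or e = -2, so d^2 + 4 (k - c) = 4.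
  Over the integers k - c is 0 or 1; the value 1 means d = 0 and is excluded by
  \<open>shift_ne\<close>, and c = k leaves parts of size |d| = 2.\<close>

lemma adjacency_equation_antisymmetric:
  assumes E: "adjacency_equation e 0 u v w z (- 1)"
    and e: "e\<^sup>2 = D\<^sup>2" and "u \<noteq> v" "w \<noteq> z"
    and ne: "\<not> (w = u \<and> z = v)" "\<not> (w = v \<and> z = u)"
  shows "c = k" "n = k + 2"
proof -
  note E1 = adjacency_equationD[OF E]
  have e0: "e \<noteq> 0" using e D_pos by auto
  have "w \<notin> {u, v} \<or> z \<notin> {u, v}" using assms(4) ne by auto
  then have "e = 2 \<or> e = - 2"
  proof
    assume "w \<notin> {u, v}"
    then show ?thesis using E1[of w] assms(4) e0 by (cases "adj w u"; cases "adj w v") auto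
  next
    assume "z \<notin> {u, v}"
    then show ?thesis using E1[of z] assms(4) e0 by (cases "adj z u"; cases "adj z v") auto
  qed
  then have "e\<^sup>2 = 4" by auto
  then have eq: "(real a - real c)\<^sup>2 + 4 * (real k - real c) = 4"
    using e D_squared by (simp add: d_def)
  have "(int a - int c)\<^sup>2 + 4 * (int k - int c) = 4"
  proof -
    have "real_of_int ((int a - int c)\<^sup>2 + 4 * (int k - int c)) = real_of_int 4" using eq by simp
    then show ?thesis by (simp only: of_int_eq_iff)
  qed
  moreover have "k - c \<noteq> 1"
  proof
    assume "k - c = 1"
    then have "real k - real c = 1" by simp
    then have "d = 0" using eq unfolding d_def by simp
    then show False using shift_ne \<open>e\<^sup>2 = 4\<close> e by simp
  qed
  moreover have "int k - int c \<le> 1"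
  proof -
    have "r \<le> 1" if "q + 4 * r = 4" "0 \<le> q" for q r :: int using that by linarith
    then show ?thesis using calculation(1) zero_le_power2 by blast
  qed
  ultimately show ck: "c = k" using c_le by linarith
  then have "d\<^sup>2 = 4" using eq unfolding d_def by simp
  then have "(real n - real k)\<^sup>2 = 2\<^sup>2"
    using d_complete_multipartite[OF ck] by (simp add: power2_commute)
  then have "real n - real k = 2" using k_le by (subst (asm) power2_eq_iff_nonneg) auto
  then show "n = k + 2" by simp
qed

end

section \<open>Transfer up to sign\<close>

lemma pst_at_uminus:
  fixes x y :: "real^'v::finite"
  shows "pst_at adj (- x) y t \<longleftrightarrow> pst_at adj x y t" "pst_at adj x (- y) t \<longleftrightarrow> pst_at adj x y t"
proof -
  have cv: "cvec (- x) = (- 1) *s cvec x" for x :: "real^'v"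
    by (simp add: cvec_def vec_eq_iff)
  have left: "pst_at adj (- x) y t" if pst: "pst_at adj x y t" for x y :: "real^'v"
  proof -
    obtain \<gamma> where \<gamma>: "transition_matrix adj t *v cvec x = \<gamma> *s cvec y"
      using pst by (auto simp: pst_at_def)
    then have "transition_matrix adj t *v cvec (- x) = (- \<gamma>) *s cvec y"
      unfolding cv vector_scalar_commute by (simp add: \<gamma> vec_eq_iff)
    then show ?thesis using pst unfolding pst_at_def by blast
  qed
  have right: "pst_at adj x (- y) t" if pst: "pst_at adj x y t" for x y :: "real^'v"
  proof -
    obtain \<gamma> where \<gamma>: "transition_matrix adj t *v cvec x = \<gamma> *s cvec y"
      using pst by (auto simp: pst_at_def)
    then have "transition_matrix adj t *v cvec x = (- \<gamma>) *s cvec (- y)"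
      by (simp add: cv vec_eq_iff)
    then show ?thesis using pst unfolding pst_at_def by blast
  qed
  show "pst_at adj (- x) y t \<longleftrightarrow> pst_at adj x y t" "pst_at adj x (- y) t \<longleftrightarrow> pst_at adj x y t"
    by (metis left minus_minus, metis right minus_minus)
qed

text \<open>The families fix states only up to sign, and a sign is absorbed by the scalar
  \<gamma>.\<close>

lemma pst_at_same_state:
  assumes "same_state x x'" "same_state y y'"
  shows "pst_at adj x y t \<longleftrightarrow> pst_at adj x' y' t"
  using assms by (auto simp: same_state_def pst_at_uminus)

context connected_srg
begin

section \<open>Complete multipartite graphs\<close>

lemma adjacent_exists: "\<exists>j. adj i j"
  using degree[of i] k_ge by (metis card.empty empty_Collect_eq not_numeral_le_zero)

lemma card_nonadjacent: "card {j. \<not> adj i j} = n - k"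
proof -
  have "card (UNIV - {j. adj i j}) = n - k"
    by (subst card_Diff_subset) (simp_all add: degree card_vertices)
  then show ?thesis by (simp add: set_diff_eq)
qed

lemma mate_exists: "\<exists>j. nonadj adj i j"
proof (rule ccontr)
  assume "\<not> ?thesis"
  then have "{j. \<not> adj i j} \<subseteq> {i}" by (auto simp: nonadj_def)
  then have "card {j. \<not> adj i j} \<le> 1" using card_mono[of "{i}" "{j. \<not> adj i j}"] by simp
  then show False using k_le card_nonadjacent[of i] by simp
qed

text \<open>The part of a vertex is the set of its non-neighbours, so it has n - k elements. Two
  vertices of one part have the same neighbours, hence c = k.\<close>

lemma complete_multipartite_params:
  assumes "complete_multipartite adj P m q"
  shows "c = k" "n = k + q" "m * q = n" "p \<in> P \<Longrightarrow> i \<in> p \<Longrightarrow> p = {j. \<not> adj i j}"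
proof -
  have P: "partition_on UNIV P" "\<And>p. p \<in> P \<Longrightarrow> card p = q" "card P = m" "2 \<le> q"
    and adj: "adj i j \<longleftrightarrow> \<not> (\<exists>p\<in>P. i \<in> p \<and> j \<in> p)" for i j
    using assms by (auto simp: complete_multipartite_def)
  have part: "p = {j. \<not> adj i j}" if "p \<in> P" "i \<in> p" for p i
  proof -
    have "p' = p" if "p' \<in> P" "i \<in> p'" for p'
      using P(1) \<open>p \<in> P\<close> \<open>i \<in> p\<close> that unfolding partition_on_def disjoint_def by blast
    then show ?thesis using that unfolding adj by blast
  qed
  then show "p \<in> P \<Longrightarrow> i \<in> p \<Longrightarrow> p = {j. \<not> adj i j}" .
  obtain p i where p: "p \<in> P" "i \<in> p"
    using P(1) by (metis UNIV_I Union_iff partition_on_def)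
  have q: "q = n - k"
    using part[OF p] P(2)[OF p(1)] card_nonadjacent[of i] by simp
  then show "n = k + q" using k_le by simp
  obtain j where j: "nonadj adj i j" using mate_exists by blast
  then have "j \<in> p" using part[OF p] by (auto simp: nonadj_def)
  then have "{l. \<not> adj i l} = {l. \<not> adj j l}" using part p by metis
  then have "{l. adj i l \<and> adj j l} = {l. adj i l}" by blast
  then show "c = k" using card_common_nonadj[OF j] degree[of i] by simp
  have "card (\<Union>P) = sum card P"
    using P(1) by (intro card_Union_disjoint) (auto simp: partition_on_def disjoint_def pairwise_def disjnt_def)
  then show "m * q = n"
    using P card_vertices by (simp add: partition_on_def)
qed

text \<open>The parts are the classes of nonadjacency, an equivalence relation by
  \<open>nonadj_same_nbrs\<close>. The second conclusion identifies a concrete set of non-neighbours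
  as a part.\<close>

lemma complete_multipartite_exists:
  assumes "c = k"
  obtains P m where "complete_multipartite adj P m (n - k)" "\<And>i. {j. \<not> adj i j} \<in> P"
proof -
  define P where "P = range (\<lambda>i. {j. \<not> adj i j})"
  note nb = nonadj_same_nbrs[OF assms]
  have eq: "{l. \<not> adj i l} = {l. \<not> adj j l}" if "\<not> adj i j" for i j
    using nb[OF that] by auto
  have "complete_multipartite adj P (card P) (n - k)"
    unfolding complete_multipartite_def
  proof (intro conjI ballI allI)
    obtain i j where ij: "adj i j" using adjacent_exists by blast
    then have "j \<in> {l. \<not> adj j l}" "j \<notin> {l. \<not> adj i l}" by simp_all
    then have "{l. \<not> adj i l} \<noteq> {l. \<not> adj j l}" by metis
    then have "card {{l. \<not> adj i l}, {l. \<not> adj j l}} = 2" by (rule card_2_iff[THEN iffD2, OF exI, OF exI, OF conjI, OF refl])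
    moreover have "card {{l. \<not> adj i l}, {l. \<not> adj j l}} \<le> card P"
      unfolding P_def by (intro card_mono) auto
    ultimately show "2 \<le> card P" by simp
    show "2 \<le> n - k" using k_le by simp
    show "partition_on UNIV P"
    proof (rule partition_onI)
      show "\<Union> P = UNIV" by (auto simp: P_def)
      show "{} \<notin> P" using irrefl unfolding P_def by blast
      fix p q assume "p \<in> P" "q \<in> P" "p \<noteq> q"
      then obtain i j where pq: "p = {l. \<not> adj i l}" "q = {l. \<not> adj j l}" by (auto simp: P_def)
      show "disjnt p q"
      proof (rule ccontr)
        assume "\<not> disjnt p q"
        then obtain l where "\<not> adj i l" "\<not> adj j l" by (auto simp: pq disjnt_def)
        then show False using eq[of i l] eq[of j l] pq \<open>p \<noteq> q\<close> by simp
      qed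
    qed
    show "adj i j \<longleftrightarrow> \<not> (\<exists>p\<in>P. i \<in> p \<and> j \<in> p)" for i j
    proof
      assume "adj i j"
      show "\<not> (\<exists>p\<in>P. i \<in> p \<and> j \<in> p)"
      proof
        assume "\<exists>p\<in>P. i \<in> p \<and> j \<in> p"
        then obtain l where "\<not> adj l i" "\<not> adj l j" by (auto simp: P_def)
        then show False using eq[of l i] \<open>adj i j\<close> by auto
      qed
    next
      assume no: "\<not> (\<exists>p\<in>P. i \<in> p \<and> j \<in> p)"
      have "{l. \<not> adj i l} \<in> P" by (simp add: P_def)
      then have "i \<notin> {l. \<not> adj i l} \<or> j \<notin> {l. \<not> adj i l}" using no by metis
      then show "adj i j" by simp
    qed
  qed (auto simp: P_def card_nonadjacent)
  then show thesis using that[of P "card P"] by (auto simp: P_def)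
qed

text \<open>In a complete multipartite graph with parts of size \<open>n - k\<close>, this is the reflection
  whose \<open>-1\<close>-eigenspace is the kernel of the adjacency matrix.\<close>

definition R :: "real^'v \<Rightarrow> real^'v" where
  "R x = (2 / (real n - real k)) *\<^sub>R (tot x *\<^sub>R ones - A *v x) - x"

lemma ev_nth: "ev u $ i = of_bool (i = u)"
  by (simp add: axis_def)

text \<open>\<open>tot x\<close> minus the i-th entry of A x is the sum of x over the vertices not
  adjacent to i, i included. In a complete multipartite graph this is a sum over the part of i, so
  \<open>R\<close> is twice the part average minus the entry.\<close>

lemma R_nth:
  "R (ev u + s *\<^sub>R ev v) $ i
    = 2 / (real n - real k) * (of_bool (\<not> adj i u) + s * of_bool (\<not> adj i v))
      - of_bool (i = u) - s * of_bool (i = v)"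
  by (simp add: R_def matrix_vector_right_distrib matrix_vector_mult_scaleR A_ev ev_nth of_bool_not_iff
      algebra_simps add_divide_distrib)

section \<open>Spectrum of a complete multipartite graph and transfer along \<open>R\<close>\<close>

context
  assumes ck: "c = k"
begin

lemma d_eq: "d = - (real n - real k)"
  using d_complete_multipartite[OF ck] .

lemma D_eq: "D = real n - real k"
proof -
  have "D\<^sup>2 = (real n - real k)\<^sup>2"
    unfolding D_squared d_eq using ck by (simp add: power2_commute)
  then show ?thesis using D_pos k_le by (subst (asm) power2_eq_iff_nonneg) auto
qed

lemma \<Theta>_eq: "\<Theta> = 0" and \<Lambda>_eq: "\<Lambda> = - (real n - real k)"
  unfolding \<Theta>_def \<Lambda>_def D_eq d_eq by simp_all

lemma part_size_pos: "0 < real n - real k"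
  using k_le by simp

text \<open>\<open>R\<close> preserves the sum over each part, and A x depends on these sums
  only.\<close>

lemma A_R: "A *v R x = A *v x"
proof -
  let ?p = "real n - real k"
  have "A *v (tot x *\<^sub>R ones - A *v x) = ?p *\<^sub>R (A *v x)"
    unfolding matrix_vector_mult_diff_distrib A_squared d_eq
    by (simp add: ck matrix_vector_mult_scaleR A_ones algebra_simps)
  then have "A *v R x = (2 / ?p) *\<^sub>R (?p *\<^sub>R (A *v x)) - A *v x"
    unfolding R_def by (subst matrix_vector_mult_diff_distrib) (simp only: matrix_vector_mult_scaleR)
  moreover have "2 / ?p * ?p = 2" using part_size_pos by (metis less_irrefl nonzero_eq_divide_eq)
  ultimately have "A *v R x = 2 *\<^sub>R (A *v x) - A *v x" by (simp only: scaleR_scaleR)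
  then show ?thesis by (simp add: vec_eq_iff)
qed

lemma tot_R: "tot (R x) = tot x"
proof -
  have "tot (R x) = 2 / (real n - real k) * ((real n - real k) * tot x) - tot x"
    by (simp add: R_def tot_A algebra_simps)
  then show ?thesis using part_size_pos by simp
qed

lemma mean_R: "mean (R x) = mean x"
  by (simp add: mean_def tot_R)

lemma A_cent: "A *v cent x = A *v x - (real k * mean x) *\<^sub>R ones"
  unfolding cent_def by (simp add: matrix_vector_mult_diff_distrib matrix_vector_mult_scaleR A_ones)

lemma X2_R: "X2 (R x) = X2 x"
  by (simp add: X2_def \<Theta>_eq A_cent A_R mean_R)

lemma X1_R: "X1 (R x) = - X1 x"
proof -
  let ?p = "real n - real k"
  have X1: "X1 v = cent v - X2 v" for v using X1_plus_X2[of v] by (simp add: algebra_simps)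
  have "cent (R x) + cent x = 2 *\<^sub>R X2 x"
  proof -
    have t: "tot x = real n * mean x" using n_pos by (simp add: mean_def)
    have c: "cent (R x) = R x - mean x *\<^sub>R ones" by (simp only: cent_def mean_R)
    have "(cent (R x) + cent x) $ i = (2 *\<^sub>R X2 x) $ i" for i
      unfolding c unfolding X2_def \<Theta>_eq D_eq A_cent R_def t
      using part_size_pos by (simp add: cent_def field_simps)
    then show ?thesis by (simp add: vec_eq_iff)
  qed
  then show ?thesis unfolding X1 X2_R by (simp add: scaleR_2 algebra_simps)
qed

text \<open>The eigenvalue 0 keeps the phase 1 and \<open>R\<close> flips its component, which
  forces \<gamma> = -1. The other components are fixed by \<open>R\<close> and must reach the phase
  \<gamma> themselves.\<close>

lemma phases_R:
  "phases \<gamma> x (R x) t \<longleftrightarrow> (mean x = 0 \<or> cis (t * real k) = \<gamma>) \<and> (X1 x = 0 \<or> \<gamma> = - 1)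
    \<and> (X2 x = 0 \<or> cis (- (t * (real n - real k))) = \<gamma>)"
proof -
  have scal: "(\<forall>i. \<omega> * complex_of_real (X $ i) = \<delta> * of_real (X $ i)) \<longleftrightarrow> X = 0 \<or> \<omega> = \<delta>"
    for \<omega> \<delta> and X :: "real^'v"
    by (auto simp: vec_eq_iff)
  have null: "(\<forall>i. cis (t * \<Theta>) * of_real (X1 x $ i) = \<gamma> * of_real (X1 (R x) $ i))
      \<longleftrightarrow> X1 x = 0 \<or> \<gamma> = - 1"
    using scal[of 1 "X1 x" "- \<gamma>"] by (auto simp: \<Theta>_eq X1_R equation_minus_iff[of 1])
  have "t * \<Lambda> = - (t * (real n - real k))" by (simp add: \<Lambda>_eq algebra_simps)
  then show ?thesis
    unfolding phases_def null unfolding mean_R X2_R scal by auto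
qed

lemma R_fixes: "X1 x = 0 \<Longrightarrow> R x = x"
  using decomposition[of x] decomposition[of "R x"] by (simp add: mean_R X1_R X2_R)

lemma R_negates: "X2 x = 0 \<Longrightarrow> mean x = 0 \<Longrightarrow> R x = - x"
  using decomposition[of x] decomposition[of "R x"] by (simp add: mean_R X1_R X2_R)

lemma part_size_le: "n - k \<le> k"
proof -
  obtain i j where ij: "adj i j" using adjacent_exists by blast
  have "{l. \<not> adj j l} \<subseteq> {l. adj i l}"
    using nonadj_same_nbrs[OF ck] ij symm by auto
  then have "card {l. \<not> adj j l} \<le> card {l. adj i l}" by (intro card_mono) auto
  then show ?thesis by (simp add: card_nonadjacent degree)
qed

text \<open>A state orthogonal to the eigenspace of the least eigenvalue has the same sum on every part,
  and a pair state meets at most two parts.\<close>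

lemma two_parts:
  assumes "X2 (ev u + s *\<^sub>R ev v) = 0" "mean (ev u + s *\<^sub>R ev v) \<noteq> 0"
  shows "n = 2 * (n - k)"
proof -
  let ?x = "ev u + s *\<^sub>R ev v"
  have "A *v cent ?x = 0" using assms(1) D_pos by (simp add: X2_def \<Theta>_eq)
  then have "(A *v ?x - (real k * mean ?x) *\<^sub>R ones) $ i = 0" for i unfolding A_cent by simp
  then have Ax: "of_bool (adj i u) + s * of_bool (adj i v) = real k * mean ?x" for i
    by (simp add: matrix_vector_right_distrib matrix_vector_mult_scaleR A_ev)
  have "1 + s = real n * mean ?x" using n_pos by (simp add: mean_def)
  \<comment> \<open>1 + s equals n times the nonzero mean and k < n. So no vertex is adjacent to
    both u and v, and the parts of u and v cover the graph.\<close>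
  then have "1 + s \<noteq> real k * mean ?x" using assms(2) part_size_pos by simp
  then have "\<not> adj i u \<or> \<not> adj i v" for i using Ax[of i] by auto
  then have "UNIV \<subseteq> {i. \<not> adj u i} \<union> {i. \<not> adj v i}" using symm by auto
  then have "CARD('v) \<le> card ({i. \<not> adj u i} \<union> {i. \<not> adj v i})" by (intro card_mono) auto
  also have "\<dots> \<le> card {i. \<not> adj u i} + card {i. \<not> adj v i}" by (rule card_Un_le)
  finally have "n \<le> 2 * (n - k)" by (simp add: card_nonadjacent card_vertices)
  then show ?thesis using part_size_le k_le by simp
qed

lemma cis_uminus_eq_minus_one: "cis (- r) = - 1 \<longleftrightarrow> cis r = - 1"
  by (auto simp: complex_eq_iff)

lemma pst_R_phases:
  assumes "pst_at adj x (R x) t" "R x \<noteq> x"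
  shows "t > 0" "mean x = 0 \<or> cis (t * real k) = - 1"
    "X2 x = 0 \<or> cis (t * (real n - real k)) = - 1"
  using assms R_fixes[of x] by (auto simp: pst_at_iff_phases phases_R cis_uminus_eq_minus_one)

text \<open>The bound is read off at the eigenvalue -p for the part size p. If that component
  vanishes, the mean does not and there are just two parts, so k = p and the phase at k gives the
  same bound.\<close>

lemma pst_R_time_ge:
  assumes "x = ev u + s *\<^sub>R ev v" "pst_at adj x (R x) t" "R x \<noteq> x" "R x \<noteq> - x"
  shows "pi / (real n - real k) \<le> t"
proof (cases "X2 x = 0")
  case False
  then show ?thesis
    using pst_R_phases[OF assms(2,3)] part_size_pos by (auto intro: cis_eq_minus_one_imp_ge)
next
  case True
  then have m: "mean x \<noteq> 0" using R_negates assms(4) by blast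
  then have "n = 2 * (n - k)" using two_parts True assms(1) by blast
  then have "n = 2 * k" using k_le by linarith
  then have "real n - real k = real k" by simp
  then show ?thesis
    using pst_R_phases[OF assms(2,3)] m k_ge cis_eq_minus_one_imp_ge[of t "real k"] by simp
qed

text \<open>k = (m - 1) p makes the phase at k the (m - 1)-th power of the phase at p. Both have to
  be -1, so m - 1 is odd; without a component at -p there are two parts.\<close>

lemma pst_R_even:
  assumes "x = ev u + s *\<^sub>R ev v" "pst_at adj x (R x) t" "R x \<noteq> x" "mean x \<noteq> 0"
    and m: "m * (n - k) = n"
  shows "even m"
proof (cases "X2 x = 0")
  case True
  then have "m * (n - k) = 2 * (n - k)" using two_parts assms(1,4) m by metis
  then show ?thesis using k_le by simp
next
  case False
  let ?p = "real n - real k"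
  have "m \<noteq> 0" using m n_pos by (metis mult_is_0 not_less_zero)
  then obtain j where j: "m = Suc j" by (cases m) auto
  have "real m * ?p = real n" using arg_cong[OF m, of real] k_le by (simp add: of_nat_diff)
  then have "real k = real j * ?p" using j by (simp add: algebra_simps)
  then have "t * real k = real j * (t * ?p)" by (metis mult.left_commute)
  then have "cis (t * real k) = cis (t * ?p) ^ j" by (simp only: Complex.DeMoivre)
  then have "(- 1 :: complex) ^ j = - 1"
    using pst_R_phases[OF assms(2,3)] False assms(4) by auto
  then have "odd j" by (cases "even j") auto
  then show ?thesis using j by simp
qed

lemma pst_R:
  assumes m: "m * (n - k) = n" and "even m \<or> tot x = 0"
  shows "pst_at adj x (R x) (pi / (real n - real k))"
proof -
  let ?p = "real n - real k"
  have "m \<noteq> 0" using m n_pos by (metis mult_is_0 not_less_zero)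
  then obtain j where j: "m = Suc j" by (cases m) auto
  have "real m * ?p = real n" using arg_cong[OF m, of real] k_le by (simp add: of_nat_diff)
  then have "pi / ?p * real k = pi * real j" using j part_size_pos by (simp add: field_simps)
  then have "cis (pi / ?p * real k) = (- 1) ^ j" by (simp add: cis_odd_multiple_pi)
  then have "mean x = 0 \<or> cis (pi / ?p * real k) = - 1"
    using assms(2) j by (auto simp: mean_def)
  moreover have "cis (- (pi / ?p * ?p)) = - 1"
    using part_size_pos by (simp add: cis_uminus_eq_minus_one)
  ultimately have "phases (- 1) x (R x) (pi / ?p)" by (simp add: phases_R)
  then show ?thesis using part_size_pos by (auto simp: pst_at_iff_phases)
qed

lemma min_pst_time_R:
  assumes "m * (n - k) = n" "even m \<or> tot x' = 0"
    and "x' = ev u + s *\<^sub>R ev v" "same_state x x'" "same_state y (R x')" "y \<noteq> x" "y \<noteq> - x"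
  shows "min_pst_time adj x y (pi / (real n - real k))"
proof -
  have "R x' \<noteq> x'" "R x' \<noteq> - x'" using assms(4-7) by (auto simp: same_state_def)
  then show ?thesis
    using pst_R_time_ge[OF assms(3)] pst_R[OF assms(1,2)]
      pst_at_same_state[OF assms(4,5)] by (auto simp: min_pst_time_def)
qed

lemma part_eq:
  assumes "finite U" "card U = n - k" "\<forall>j\<in>U. \<not> adj j u"
  shows "\<not> adj i u \<longleftrightarrow> i \<in> U"
proof -
  have "U \<subseteq> {j. \<not> adj u j}" using assms(3) symm by auto
  then have "U = {j. \<not> adj u j}"
    using assms(2) card_nonadjacent[of u] by (intro card_subset_eq) auto
  then show ?thesis using symm by auto
qed

text \<open>For parts of size two, twice the average minus the entry is the entry of the other
  vertex.\<close>

lemma R_part_size_2: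
  assumes "n = k + 2" "nonadj adj u w" "nonadj adj v z"
  shows "R (ev u + s *\<^sub>R ev v) = ev w + s *\<^sub>R ev z"
proof -
  have "\<not> adj w u" "\<not> adj z v" using assms symm[of w u] symm[of z v] by (auto simp: nonadj_def)
  then have "\<not> adj i u \<longleftrightarrow> i = u \<or> i = w" "\<not> adj i v \<longleftrightarrow> i = v \<or> i = z" for i
    using part_eq[of "{u, w}" u i] part_eq[of "{v, z}" v i] assms by (auto simp: nonadj_def)
  then have "R (ev u + s *\<^sub>R ev v) $ i = (ev w + s *\<^sub>R ev z) $ i" for i
    using assms unfolding R_nth by (auto simp: nonadj_def axis_def)
  then show ?thesis by (simp add: vec_eq_iff)
qed

lemma R_single_part:
  assumes "finite U" "card U = n - k" "{u, v} \<subseteq> U" "\<And>i j. i \<in> U \<Longrightarrow> j \<in> U \<Longrightarrow> \<not> adj i j"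
  shows "R (ev u + s *\<^sub>R ev v) $ i
    = 2 / (real n - real k) * (1 + s) * of_bool (i \<in> U) - of_bool (i = u) - s * of_bool (i = v)"
  unfolding R_nth using part_eq[of U u i] part_eq[of U v i] assms by auto

end


section \<open>Classification\<close>

text \<open>The sum of x and R x is constant on each part, and zero on parts that x does not meet.
  If u and v lie in different parts, {u, v, w, z} covers both, so each has two vertices. If they
  share a part, that part is {u, v, w, z}, and equality of the sums on it determines s from the
  overlap pattern.\<close>

lemma reflected_pair_states:
  assumes ck: "c = k" and "u \<noteq> v" "w \<noteq> z" "s \<noteq> 0"
    and R: "R (ev u + s *\<^sub>R ev v) = ev w + s *\<^sub>R ev z"
    and ne: "ev w + s *\<^sub>R ev z \<noteq> ev u + s *\<^sub>R ev v" "ev w + s *\<^sub>R ev z \<noteq> - (ev u + s *\<^sub>R ev v)"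
  shows "n = k + 2 \<and> nonadj adj u w \<and> nonadj adj v z
    \<or> n = k + 2 \<and> s = 1 \<and> nonadj adj u z \<and> nonadj adj v w
    \<or> n = k + 3 \<and> {j. \<not> adj u j} = {u, v, z} \<and> w = u \<and> s = 2 \<and> z \<noteq> v
    \<or> n = k + 3 \<and> {j. \<not> adj u j} = {u, v, w} \<and> z = v \<and> s = 1 / 2 \<and> w \<noteq> u
    \<or> n = k + 4 \<and> {j. \<not> adj u j} = {u, v, w, z} \<and> s = 1"
proof -
  let ?p = "real n - real k"
  note p0 = part_size_pos[OF ck]
  note nb = nonadj_same_nbrs[OF ck]
  have sum_eq: "of_bool (i = u) + s * of_bool (i = v) + of_bool (i = w) + s * of_bool (i = z)
      = 2 / ?p * (of_bool (\<not> adj i u) + s * of_bool (\<not> adj i v))" for i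
    using R_nth[of u s v i] unfolding R by (simp add: ev_nth)
  show ?thesis
  proof (cases "adj u v")
    case True
    obtain u' where u': "nonadj adj u u'" using mate_exists by blast
    obtain v' where v': "nonadj adj v v'" using mate_exists by blast
    have vu: "adj v u" using True symm by simp
    \<comment> \<open>Such a vertex lies in the part of u, where the sum of both states is 2 / p,
      but in neither u nor v; so it supports the second state.\<close>
    have in_wz_u: "(i = w \<or> i = z) \<and> adj i v \<and> i \<noteq> v" if "nonadj adj u i" for i
    proof -
      have i: "i \<noteq> u" "\<not> adj i u" "adj i v" "i \<noteq> v"
        using that nb[of u i v] True symm[of u i] by (auto simp: nonadj_def)
      then show ?thesis using sum_eq[of i] p0 by (cases "i = w"; cases "i = z") auto
    qed
    have in_wz_v: "(i = w \<or> i = z) \<and> adj i u \<and> i \<noteq> u" if "nonadj adj v i" for i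
    proof -
      have i: "i \<noteq> v" "\<not> adj i v" "adj i u" "i \<noteq> u"
        using that nb[of v i u] vu symm[of v i] by (auto simp: nonadj_def)
      then show ?thesis using sum_eq[of i] p0 assms(4) by (cases "i = w"; cases "i = z") auto
    qed
    have "u' \<noteq> v'" using in_wz_u[OF u'] v' symm[of u' v] by (auto simp: nonadj_def)
    then have "i = u'" if "nonadj adj u i" for i
    proof -
      have "i \<noteq> v'" using in_wz_u[OF that] v' symm[of i v] by (auto simp: nonadj_def)
      then show ?thesis using in_wz_u[OF that] in_wz_u[OF u'] in_wz_v[OF v'] \<open>u' \<noteq> v'\<close> by auto
    qed
    then have "{j. nonadj adj u j} = {u'}" using u' by blast
    moreover have "{j. \<not> adj u j} = insert u {j. nonadj adj u j}" by (auto simp: nonadj_def)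
    ultimately have "{j. \<not> adj u j} = {u, u'}" by simp
    then have "n - k = card {u, u'}" using card_nonadjacent[of u] by simp
    then have n: "n = k + 2" using u' k_le by (simp add: nonadj_def)
    show ?thesis
    proof (cases "u' = w")
      case True
      then have "v' = z" using in_wz_v[OF v'] \<open>u' \<noteq> v'\<close> by auto
      then show ?thesis using True u' v' n by simp
    next
      case False
      then have z: "u' = z" using in_wz_u[OF u'] by auto
      then have w: "v' = w" using in_wz_v[OF v'] \<open>u' \<noteq> v'\<close> by auto
      have "s = 1"
        using sum_eq[of z] n u' z in_wz_u[OF u'] assms(3) symm[of u z] by (auto simp: nonadj_def)
      then show ?thesis using z w u' v' n by simp
    qed
  next
    case False
    have same: "adj i u \<longleftrightarrow> adj i v" for i using nb[OF False, of i] symm by auto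
    define h where "h = 2 / ?p * (1 + s)"
    have sum_h: "of_bool (i = u) + s * of_bool (i = v) + of_bool (i = w) + s * of_bool (i = z)
        = h * of_bool (\<not> adj i u)" for i
      using sum_eq[of i] by (cases "adj i u") (simp_all add: same h_def)
    \<comment> \<open>h = 0 would make the two states opposite.\<close>
    have h0: "h \<noteq> 0"
    proof
      assume "h = 0"
      have "(ev w + s *\<^sub>R ev z) $ i = (- (ev u + s *\<^sub>R ev v)) $ i" for i
        using sum_h[of i] \<open>h = 0\<close> by (simp add: ev_nth)
      then show False using ne(2) by (simp add: vec_eq_iff)
    qed
    have part: "{j. \<not> adj u j} = {u, v, w, z}"
    proof (intro equalityI subsetI)
      fix i assume "i \<in> {j. \<not> adj u j}"
      then have "\<not> adj i u" using symm[of u i] by simp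
      then show "i \<in> {u, v, w, z}" using sum_h[of i] h0 by auto
    next
      fix i assume i: "i \<in> {u, v, w, z}"
      have "\<not> adj w u"
        using sum_h[of w] assms(3) False symm[of u v] by (cases "w = u"; cases "w = v") auto
      moreover have "\<not> adj z u"
        using sum_h[of z] assms(3,4) False symm[of u v] by (cases "z = u"; cases "z = v") auto
      ultimately show "i \<in> {j. \<not> adj u j}" using i False symm[of u w] symm[of u z] by auto
    qed
    then have p: "n - k = card {u, v, w, z}" using card_nonadjacent[of u] by simp
    have eq: "of_bool (i = u) + s * of_bool (i = v) + of_bool (i = w) + s * of_bool (i = z) = h"
      if "i \<in> {u, v, w, z}" for i
    proof -
      have "\<not> adj u i" using that part by blast
      then show ?thesis using sum_h[of i] symm[of i u] by simp
    qed
    have "\<not> (w = u \<and> z = v)" using ne(1) by auto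
    then consider "distinct [u, v, w, z]" | "w = u" "z \<notin> {u, v}" | "w = v" "z \<notin> {u, v}"
      | "z = u" "w \<notin> {u, v}" | "z = v" "w \<notin> {u, v}" | "w = v" "z = u"
      using assms(2,3) by auto
    then show ?thesis
    proof cases
      case 1
      then have n: "n = k + 4" using p k_le by simp
      have "s = 1" using eq[of u] eq[of v] 1 by auto
      then show ?thesis using n part by simp
    next
      case 2
      then have n: "n = k + 3" using p assms(2) k_le by (auto simp: insert_commute)
      have "s = 2" using eq[of u] eq[of v] 2 assms(2) by auto
      moreover have "{u, v, w, z} = {u, v, z}" using 2 by auto
      ultimately show ?thesis using n part 2 by simp
    next
      case 3
      then show ?thesis using eq[of u] eq[of v] assms(2,4) n_pos
        using 3 p k_le by (auto simp: h_def insert_commute)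
    next
      case 4
      then show ?thesis using eq[of u] eq[of v] assms(2) by auto
    next
      case 5
      then have n: "n = k + 3" using p assms(2) k_le by (auto simp: insert_commute)
      have "h = 1" using eq[of u] 5 assms(2) by auto
      then have "s = 1 / 2" using n by (simp add: h_def)
      moreover have "{u, v, w, z} = {u, v, w}" using 5 by auto
      ultimately show ?thesis using n part 5 by simp
    next
      case 6
      then have "n = k + 2" using p assms(2) k_le by (auto simp: insert_commute)
      then show ?thesis using 6 False assms(2) symm[of u v] by (auto simp: nonadj_def)
    qed
  qed
qed

section \<open>The exceptional transfer on the 4-cycle\<close>

text \<open>The bounds on k force k = 2, so every vertex has a single nonadjacent mate, with the
  same two neighbours.\<close>

lemma four_vertices:
  assumes "n = 4"
  shows "c = k" "n = k + 2"
proof -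
  show n: "n = k + 2" using assms k_ge k_le by simp
  obtain i j where ij: "nonadj adj i j" using mate_exists by blast
  have "{l. \<not> adj i l} = {i, j}" "{l. \<not> adj j l} = {i, j}"
    using ij n card_nonadjacent[of i] card_nonadjacent[of j] symm[of i j]
    by (intro card_subset_eq[symmetric]; auto simp: nonadj_def)+
  then have "{l. adj i l \<and> adj j l} = {l. adj i l}" by blast
  then show "c = k" using card_common_nonadj[OF ij] degree[of i] by simp
qed

lemma complement_components:
  assumes "y = (2 * mean x) *\<^sub>R ones - x"
  shows "mean y = mean x" "X1 y = - X1 x" "X2 y = - X2 x"
proof -
  show m: "mean y = mean x"
    using n_pos by (simp add: assms mean_def field_simps)
  have c: "cent y = - cent x"
    unfolding cent_def m unfolding assms by (simp add: vec_eq_iff)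
  have "A *v (- cent x) = - (A *v cent x)"
    using matrix_vector_mult_scaleR[of A "- 1" "cent x"] by simp
  then show "X1 y = - X1 x" "X2 y = - X2 x"
    unfolding X1_def X2_def c by (simp_all add: vec_eq_iff algebra_simps)
qed

text \<open>Only the components at k and at \<open>\<Lambda>\<close> are present, and just the
  second is flipped. What counts is their relative phase, and k - \<Lambda> = n.\<close>

lemma pst_at_complement:
  assumes ck: "c = k" and y: "y = (2 * mean x) *\<^sub>R ones - x"
    and "X1 x = 0" "X2 x \<noteq> 0" "mean x \<noteq> 0"
  shows "pst_at adj x y t \<longleftrightarrow> t > 0 \<and> cis (t * real n) = - 1"
proof -
  obtain j where j: "X2 x $ j \<noteq> 0" using assms(4) by (auto simp: vec_eq_iff)
  have "phases \<gamma> x y t \<longleftrightarrow> cis (t * real k) = \<gamma> \<and> cis (t * \<Lambda>) = - \<gamma>" for \<gamma>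
  proof -
    have "(\<forall>i. cis (t * \<Lambda>) * of_real (X2 x $ i) = \<gamma> * of_real ((- X2 x) $ i))
        \<longleftrightarrow> cis (t * \<Lambda>) = - \<gamma>"
    proof
      assume "\<forall>i. cis (t * \<Lambda>) * of_real (X2 x $ i) = \<gamma> * of_real ((- X2 x) $ i)"
      then have "cis (t * \<Lambda>) * of_real (X2 x $ j) = (- \<gamma>) * of_real (X2 x $ j)" by simp
      then show "cis (t * \<Lambda>) = - \<gamma>" using j by (simp only: mult_cancel_right of_real_eq_0_iff) simp
    qed simp
    then show ?thesis
      unfolding phases_def complement_components[OF y] using assms(3,5) by simp
  qed
  moreover have "cis (t * \<Lambda>) = - cis (t * real k) \<longleftrightarrow> cis (t * real n) = - 1"
  proof -
    have "t * real k = t * real n + t * \<Lambda>" by (simp add: \<Lambda>_eq[OF ck] algebra_simps)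
    then have "cis (t * real k) = cis (t * real n) * cis (t * \<Lambda>)" by (simp add: cis_mult)
    then have "cis (t * \<Lambda>) = - cis (t * real k)
        \<longleftrightarrow> (cis (t * real n) + 1) * cis (t * \<Lambda>) = 0"
      by (simp add: distrib_right eq_neg_iff_add_eq_0 add.commute)
    then show ?thesis by (simp add: eq_neg_iff_add_eq_0)
  qed
  ultimately show ?thesis by (auto simp: pst_at_iff_phases)
qed

context
  fixes u v w z :: 'v
  assumes n4: "n = 4" and distinct4: "distinct [u, v, w, z]"
begin

lemma vertices4: "i = u \<or> i = v \<or> i = w \<or> i = z"
proof -
  have "card {u, v, w, z} = CARD('v)" using distinct4 n4 card_vertices by simp
  then have "{u, v, w, z} = UNIV" by (intro card_subset_eq) auto
  then show ?thesis by blast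
qed

lemma complement4: "ev w + ev z = ones - (ev u + ev v)"
proof -
  have "(ev w + ev z) $ i = (ones - (ev u + ev v)) $ i" for i
    using vertices4[of i] distinct4 by (auto simp: ev_nth)
  then show ?thesis by (simp add: vec_eq_iff)
qed

lemma mates4:
  assumes "nonadj adj u v"
  shows "adj i u \<longleftrightarrow> i \<noteq> u \<and> i \<noteq> v" "adj i v \<longleftrightarrow> i \<noteq> u \<and> i \<noteq> v"
    "adj i w \<longleftrightarrow> i \<noteq> w \<and> i \<noteq> z" "adj i z \<longleftrightarrow> i \<noteq> w \<and> i \<noteq> z" "nonadj adj w z"
proof -
  note ck = four_vertices(1)[OF n4] and nk = four_vertices(2)[OF n4]
  have two: "adj i q \<longleftrightarrow> i \<noteq> q \<and> i \<noteq> r" if "nonadj adj q r" for i q r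
    using part_eq[OF ck, of "{q, r}" q i] that nk symm[of q r] by (auto simp: nonadj_def)
  have sy: "nonadj adj q r \<Longrightarrow> nonadj adj r q" for q r
    using symm[of q r] by (auto simp: nonadj_def)
  show u: "adj i u \<longleftrightarrow> i \<noteq> u \<and> i \<noteq> v" for i using two[OF assms] .
  show v: "adj i v \<longleftrightarrow> i \<noteq> u \<and> i \<noteq> v" for i using two[OF sy[OF assms]] by auto
  obtain q where q: "nonadj adj w q" using mate_exists by blast
  then have "q = z"
    using vertices4[of q] u[of w] v[of w] distinct4 by (auto simp: nonadj_def)
  then show wz: "nonadj adj w z" using q by simp
  show "adj i w \<longleftrightarrow> i \<noteq> w \<and> i \<noteq> z" using two[OF wz] .
  show "adj i z \<longleftrightarrow> i \<noteq> w \<and> i \<noteq> z" using two[OF sy[OF wz]] by auto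
qed

lemma is_C4_of_nonadj:
  assumes "nonadj adj u v"
  shows "is_C4 adj"
proof -
  \<comment> \<open>The order u, w, v, z alternates between the two parts.\<close>
  define f where "f i = [u, w, v, z] ! i" for i :: nat
  have lt4: "i < 4 \<longleftrightarrow> i = 0 \<or> i = 1 \<or> i = 2 \<or> i = 3" for i :: nat by auto
  have f: "f 0 = u" "f 1 = w" "f 2 = v" "f 3 = z" "f (Suc 0) = w" by (simp_all add: f_def)
  have img: "{..<4} = {0, 1, 2, 3 :: nat}" by auto
  have "bij_betw f {..<4} UNIV"
    unfolding bij_betw_def img inj_on_def using distinct4 vertices4 by (auto simp: f)
  moreover have "adj (f i) (f j) \<longleftrightarrow> j = (i + 1) mod 4 \<or> i = (j + 1) mod 4"
    if "i < 4" "j < 4" for i j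
  proof -
    have "u \<noteq> v" "u \<noteq> w" "u \<noteq> z" "v \<noteq> u" "v \<noteq> w" "v \<noteq> z"
      "w \<noteq> u" "w \<noteq> v" "w \<noteq> z" "z \<noteq> u" "z \<noteq> v" "z \<noteq> w"
      using distinct4 by auto
    note facts = this f mates4(1-4)[OF assms]
    from that show ?thesis
      unfolding lt4 by (elim disjE; simp add: facts)
  qed
  ultimately show ?thesis by (auto simp: is_C4_def)
qed

text \<open>The state is constant on the two parts {u, v} and {w, z}, so \<open>R\<close> fixes it
  and its component at 0 vanishes. The complement transfer then has minimum time pi / n.\<close>

lemma min_pst_time_4:
  assumes "nonadj adj u v"
  shows "min_pst_time adj (ev u + ev v) (ev w + ev z) (pi / 4)"
proof -
  note ck = four_vertices(1)[OF n4] and nk = four_vertices(2)[OF n4]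
  let ?x = "ev u + ev v"
  have m: "mean ?x = 1 / 2" unfolding mean_def by (simp add: n4)
  have "R ?x = ?x"
    using R_part_size_2[OF ck nk, of u v v u 1] assms symm[of u v]
    by (auto simp: nonadj_def add.commute)
  then have "X1 ?x = - X1 ?x" using X1_R[OF ck, of ?x] by (simp only:)
  then have X1: "X1 ?x = 0" by (simp add: vec_eq_iff)
  have X2: "X2 ?x \<noteq> 0"
  proof
    assume "X2 ?x = 0"
    then have "?x = mean ?x *\<^sub>R ones" using decomposition[of ?x] X1 by simp
    then have "?x $ w = (mean ?x *\<^sub>R ones) $ w" by simp
    then show False using m distinct4 by (auto simp: ev_nth)
  qed
  have y: "ev w + ev z = (2 * mean ?x) *\<^sub>R ones - ?x"
    by (simp add: m complement4)
  have "real n = 4" using n4 by simp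
  have "pst_at adj ?x (ev w + ev z) t \<longleftrightarrow> t > 0 \<and> cis (t * 4) = - 1" for t
    using pst_at_complement[OF ck y X1 X2, of t, unfolded \<open>real n = 4\<close>] m by simp
  then show ?thesis
    using cis_eq_minus_one_imp_ge[of _ 4] by (auto simp: min_pst_time_def)
qed

end

section \<open>Transfer in the four families\<close>

lemma C4_states_min_pst_time:
  assumes "C4_states adj x y" "y \<noteq> x" "y \<noteq> - x"
  shows "min_pst_time adj x y (pi / 4)"
proof -
  obtain u v w z where C4: "is_C4 adj" and uv: "nonadj adj u v" and wz: "nonadj adj w z"
    and x: "same_state x (ev u + ev v)" and y: "same_state y (ev w + ev z)"
    using assms(1) by (auto simp: C4_states_def)
  have n4: "n = 4"
    using C4 bij_betw_same_card card_vertices by (fastforce simp: is_C4_def)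
  have "ev w + ev z \<noteq> ev u + ev v"
    using assms(2,3) x y unfolding same_state_def by (metis minus_minus)
  then have ne: "\<not> (w = u \<and> z = v)" "\<not> (w = v \<and> z = u)" by (auto simp: add.commute)
  have two: "\<not> adj i q \<longleftrightarrow> i = q \<or> i = r" if "nonadj adj q r" for i q r
    using part_eq[OF four_vertices(1)[OF n4], of "{q, r}" q i] that four_vertices(2)[OF n4]
      symm[of q r]
    by (auto simp: nonadj_def)
  have vu: "nonadj adj v u" and zw: "nonadj adj z w"
    using uv wz symm[of u v] symm[of w z] by (auto simp: nonadj_def)
  have "distinct [u, v, w, z]"
    using uv wz ne two[OF uv, of w] two[OF uv, of z] two[OF vu, of w] two[OF vu, of z]
      symm[of w z] symm[of u v]
    by (auto simp: nonadj_def)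
  from min_pst_time_4[OF n4 this uv] show ?thesis
    unfolding min_pst_time_def pst_at_same_state[OF x y] .
qed

lemma CP_states_min_pst_time:
  assumes "CP_states adj x y" "y \<noteq> x" "y \<noteq> - x"
  shows "min_pst_time adj x y (pi / 2)"
proof -
  obtain m P where P: "complete_multipartite adj P m 2" and alt:
    "(\<exists>u v w z. nonadj adj u z \<and> nonadj adj v w \<and>
         same_state x (ev u - ev v) \<and> same_state y (ev w - ev z)) \<or>
      (even m \<and> (\<exists>u v w z s. nonadj adj u w \<and> nonadj adj v z \<and>
         same_state x (ev u + s *\<^sub>R ev v) \<and> same_state y (ev w + s *\<^sub>R ev z)))"
    using assms(1) unfolding CP_states_def is_CP_def by blast
  note par = complete_multipartite_params[OF P]
  have p: "n - k = 2" "real n - real k = 2" using par(2) by simp_all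
  from alt show ?thesis
  proof (elim disjE exE conjE)
    fix u v w z
    assume uz: "nonadj adj u z" "nonadj adj v w"
      and st: "same_state x (ev u - ev v)" "same_state y (ev w - ev z)"
    \<comment> \<open>The entries sum to zero, so the parity of m is irrelevant to the transfer
      along \<open>R\<close>.\<close>
    have "R (ev u + (- 1) *\<^sub>R ev v) = - (ev w - ev z)"
      unfolding R_part_size_2[OF par(1,2) uz] by simp
    then have "same_state y (R (ev u + (- 1) *\<^sub>R ev v))" "same_state x (ev u + (- 1) *\<^sub>R ev v)"
      using st by (auto simp: same_state_def)
    then show ?thesis
      using min_pst_time_R[OF par(1), of m "ev u + (- 1) *\<^sub>R ev v" u "- 1" v x y] par(3) p assms(2,3)
      by simp
  next
    fix u v w z s
    assume m: "even m" and uw: "nonadj adj u w" "nonadj adj v z"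
      and st: "same_state x (ev u + s *\<^sub>R ev v)" "same_state y (ev w + s *\<^sub>R ev z)"
    then show ?thesis
      using min_pst_time_R[OF par(1), of m "ev u + s *\<^sub>R ev v" u s v x y]
        R_part_size_2[OF par(1,2) uw, of s] par(3) p assms(2,3)
      by simp
  qed
qed

lemma K3_states_min_pst_time:
  assumes "K3_states adj x y" "y \<noteq> x" "y \<noteq> - x"
  shows "min_pst_time adj x y (pi / 3)"
proof -
  obtain m P u v w p where m: "even m" and P: "complete_multipartite adj P m 3"
    and uv: "u \<noteq> v" "w \<noteq> v" and p: "p \<in> P" "{u, v, w} \<subseteq> p" and alt:
    "same_state x (ev u + (1/2) *\<^sub>R ev v) \<and> same_state y (ev w + (1/2) *\<^sub>R ev v) \<or>
     same_state x (2 *\<^sub>R ev u + ev v) \<and> same_state y (2 *\<^sub>R ev w + ev v)"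
    using assms(1) unfolding K3_states_def by blast
  note par = complete_multipartite_params[OF P]
  have q: "n - k = 3" "real n - real k = 3" using par(2) by simp_all
  have uw: "u \<noteq> w" using alt assms(2,3) by (auto simp: same_state_def)
  have na: "\<not> adj i j" if "i \<in> {u, v, w}" "j \<in> {u, v, w}" for i j
    using par(4)[OF p(1), of i] p(2) that by blast
  have card: "card {u, v, w} = n - k" using q uv uw by auto
  have R_nth': "R (ev i + s *\<^sub>R ev j) $ l = 2 / 3 * (1 + s) * of_bool (l \<in> {u, v, w})
      - of_bool (l = i) - s * of_bool (l = j)" if "{i, j} \<subseteq> {u, v, w}" for i j l s
    unfolding q(2)[symmetric] by (rule R_single_part[OF par(1) _ card that na]) simp_all
  \<comment> \<open>The second form is read as \<open>ev v + 2 *\<^sub>R ev u\<close>, that is with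
    s = 2 and the fixed vertex in front.\<close>
  have "R (ev u + (1/2) *\<^sub>R ev v) $ l = (ev w + (1/2) *\<^sub>R ev v) $ l"
    "R (ev v + 2 *\<^sub>R ev u) $ l = (ev v + 2 *\<^sub>R ev w) $ l" for l
    using uv uw by (subst R_nth'; force simp: ev_nth)+
  then have R1: "R (ev u + (1/2) *\<^sub>R ev v) = ev w + (1/2) *\<^sub>R ev v"
    and R2: "R (ev v + 2 *\<^sub>R ev u) = ev v + 2 *\<^sub>R ev w"
    by (simp_all add: vec_eq_iff)
  from alt show ?thesis
  proof
    assume "same_state x (ev u + (1/2) *\<^sub>R ev v) \<and> same_state y (ev w + (1/2) *\<^sub>R ev v)"
    then show ?thesis
      using min_pst_time_R[OF par(1), of m "ev u + (1/2) *\<^sub>R ev v" u "1/2" v x y] R1 m par(3) q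
        assms(2,3)
      by simp
  next
    assume "same_state x (2 *\<^sub>R ev u + ev v) \<and> same_state y (2 *\<^sub>R ev w + ev v)"
    then show ?thesis
      using min_pst_time_R[OF par(1), of m "ev v + 2 *\<^sub>R ev u" v 2 u x y] R2 m par(3) q
        assms(2,3)
      by (simp add: add.commute)
  qed
qed

lemma K4_states_min_pst_time:
  assumes "K4_states adj x y" "y \<noteq> x" "y \<noteq> - x"
  shows "min_pst_time adj x y (pi / 4)"
proof -
  obtain m P u v w z where m: "even m" and P: "complete_multipartite adj P m 4"
    and p: "{u, v, w, z} \<in> P" and st: "same_state x (ev u + ev v)" "same_state y (ev w + ev z)"
    using assms(1) unfolding K4_states_def by blast
  note par = complete_multipartite_params[OF P]
  have q: "n - k = 4" "real n - real k = 4" using par(2) by simp_all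
  have card: "card {u, v, w, z} = n - k"
    using P p q by (simp add: complete_multipartite_def)
  have dist: "distinct [u, v, w, z]"
    using card q card_distinct[of "[u, v, w, z]"] by simp
  have na: "\<not> adj i j" if "i \<in> {u, v, w, z}" "j \<in> {u, v, w, z}" for i j
    using par(4)[OF p, of i] that by blast
  have "R (ev u + 1 *\<^sub>R ev v) $ i = (ev w + ev z) $ i" for i
  proof -
    have "R (ev u + 1 *\<^sub>R ev v) $ i = 2 / (real n - real k) * (1 + 1) * of_bool (i \<in> {u, v, w, z})
        - of_bool (i = u) - 1 * of_bool (i = v)"
      by (rule R_single_part[OF par(1) _ card _ na]) simp_all
    then show ?thesis unfolding q using dist by (simp add: ev_nth) auto
  qed
  then have "R (ev u + 1 *\<^sub>R ev v) = ev w + ev z" by (simp add: vec_eq_iff)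
  then show ?thesis
    using min_pst_time_R[OF par(1), of m "ev u + 1 *\<^sub>R ev v" u 1 v x y] m par(3) q st assms(2,3)
    by simp
qed

section \<open>Necessity\<close>

lemma CP_statesI:
  assumes "is_CP adj m" "2 \<le> m" "even m" "u \<noteq> v" "w \<noteq> z" "s \<noteq> 0" "nonadj adj u w" "nonadj adj v z"
    and "x = ev u + s *\<^sub>R ev v" "y = ev w + s *\<^sub>R ev z"
  shows "CP_states adj x y"
  unfolding CP_states_def
  by (intro exI[of _ m] conjI disjI2 exI[of _ u] exI[of _ v] exI[of _ w] exI[of _ z] exI[of _ s])
    (use assms in \<open>simp_all add: same_state_def\<close>)

lemma K3_statesI:
  assumes "even m" "complete_multipartite adj P m 3" "{u, v, w} \<in> P" "u \<noteq> v" "w \<noteq> v"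
    and "x = ev u + (1/2) *\<^sub>R ev v \<and> y = ev w + (1/2) *\<^sub>R ev v
      \<or> x = 2 *\<^sub>R ev u + ev v \<and> y = 2 *\<^sub>R ev w + ev v"
  shows "K3_states adj x y"
proof -
  have part: "\<exists>p\<in>P. {u, v, w} \<subseteq> p" using assms(3) by (intro bexI[of _ "{u, v, w}"]) simp_all
  have st: "same_state x (ev u + (1/2) *\<^sub>R ev v) \<and> same_state y (ev w + (1/2) *\<^sub>R ev v)
      \<or> same_state x (2 *\<^sub>R ev u + ev v) \<and> same_state y (2 *\<^sub>R ev w + ev v)"
    using assms(6) unfolding same_state_def by argo
  show ?thesis
    unfolding K3_states_def
    by (intro exI[of _ m] exI[of _ P] conjI exI[of _ u] exI[of _ v] exI[of _ w])
      (fact assms(1,2,4,5) part st)+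
qed

lemma K4_statesI:
  assumes "even m" "complete_multipartite adj P m 4" "{u, v, w, z} \<in> P"
    and "x = ev u + ev v" "y = ev w + ev z"
  shows "K4_states adj x y"
  unfolding K4_states_def
  by (intro exI[of _ m] exI[of _ P] conjI exI[of _ u] exI[of _ v] exI[of _ w] exI[of _ z])
    (use assms in \<open>auto simp: same_state_def\<close>)

lemma CP_states_antisymmetricI:
  assumes "is_CP adj m" "2 \<le> m" "u \<noteq> v" "w \<noteq> z" "nonadj adj u z" "nonadj adj v w"
    and "x = ev u - ev v" "same_state y (ev w - ev z)"
  shows "CP_states adj x y"
  unfolding CP_states_def
  by (intro exI[of _ m] conjI disjI1 exI[of _ u] exI[of _ v] exI[of _ w] exI[of _ z])
    (use assms in \<open>simp_all add: same_state_def\<close>)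

lemma norm_pair_state:
  assumes "u \<noteq> v"
  shows "norm (ev u + s *\<^sub>R ev v) = sqrt (1 + s\<^sup>2)"
proof -
  have "(ev u + s *\<^sub>R ev v) \<bullet> (ev u + s *\<^sub>R ev v) = 1 + s\<^sup>2"
    using assms by (simp add: inner_add_left inner_add_right inner_axis axis_nth power2_eq_square)
      (simp add: axis_def)
  then show ?thesis by (simp add: norm_eq_sqrt_inner)
qed

text \<open>If u v is not an edge, this is the C4 family. Otherwise w and z are the mates of u and v
  in some order, and equal weights allow them to be named to fit the CP family with m = 2.\<close>

lemma complement_states:
  assumes "n = 4" "distinct [u, v, w, z]"
  shows "C4_states adj (ev u + ev v) (ev w + ev z) \<or> CP_states adj (ev u + ev v) (ev w + ev z)"
proof (cases "adj u v")
  case False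
  then have uv: "nonadj adj u v" using assms(2) by (simp add: nonadj_def)
  show ?thesis
    using is_C4_of_nonadj[OF assms uv] mates4(5)[OF assms uv] uv
    by (auto simp: C4_states_def same_state_def)
next
  case True
  note ck = four_vertices(1)[OF assms(1)] and nk = four_vertices(2)[OF assms(1)]
  obtain P m where P: "complete_multipartite adj P m (n - k)"
    using complete_multipartite_exists[OF ck] by blast
  then have P2: "complete_multipartite adj P m 2" using nk by simp
  then have m2: "m = 2" using complete_multipartite_params(3)[OF P2] assms(1) by simp
  obtain q where uq: "nonadj adj u q" using mate_exists by blast
  then have "q \<noteq> v" using True by (auto simp: nonadj_def)
  then have "q = w \<or> q = z" using vertices4[OF assms, of q] uq by (auto simp: nonadj_def)
  then have "nonadj adj u w \<and> nonadj adj v z \<or> nonadj adj u z \<and> nonadj adj v w"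
  proof
    assume "q = w"
    then have "distinct [u, w, v, z]" "nonadj adj u w" using assms(2) uq by auto
    then show ?thesis using mates4(5)[OF assms(1)] by blast
  next
    assume "q = z"
    then have "distinct [u, z, v, w]" "nonadj adj u z" using assms(2) uq by auto
    then show ?thesis using mates4(5)[OF assms(1)] by blast
  qed
  then have "\<exists>w' z'. nonadj adj u w' \<and> nonadj adj v z' \<and> w' \<noteq> z' \<and> ev w + ev z = ev w' + ev z'"
  proof
    assume "nonadj adj u w \<and> nonadj adj v z"
    then show ?thesis using assms(2) by (intro exI[of _ w] exI[of _ z]) simp
  next
    assume "nonadj adj u z \<and> nonadj adj v w"
    then show ?thesis using assms(2) by (intro exI[of _ z] exI[of _ w]) (auto simp: add.commute)
  qed
  then obtain w' z' where "nonadj adj u w'" "nonadj adj v z'" "w' \<noteq> z'" "ev w + ev z = ev w' + ev z'"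
    by blast
  then show ?thesis
    using CP_statesI[of m u v w' z' 1 "ev u + ev v" "ev w + ev z"] P2 m2 assms(2)
    by (auto simp: is_CP_def)
qed

lemma reflected_states:
  assumes ck: "c = k" and "u \<noteq> v" "w \<noteq> z" "s \<noteq> 0" "s \<noteq> - 1"
    and x: "x = ev u + s *\<^sub>R ev v" and y: "y = ev w + s *\<^sub>R ev z"
    and R: "y = R x" and "y \<noteq> x" "y \<noteq> - x" and pst: "pst_at adj x y t"
  shows "CP_states adj x y \<or> K3_states adj x y \<or> K4_states adj x y"
proof -
  obtain P m where P: "complete_multipartite adj P m (n - k)" and parts: "\<And>i. {j. \<not> adj i j} \<in> P"
    using complete_multipartite_exists[OF ck] by blast
  have "mean x \<noteq> 0" using assms(5) n_pos by (simp add: x mean_def)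
  then have m: "even m"
    using pst_R_even[OF ck x] pst assms(9) complete_multipartite_params(3)[OF P] by (simp add: R)
  have m2: "m \<ge> 2" using P by (simp add: complete_multipartite_def)
  from reflected_pair_states[OF ck assms(2-4)] R assms(9,10)
  consider "n = k + 2" "nonadj adj u w" "nonadj adj v z"
    | "n = k + 2" "s = 1" "nonadj adj u z" "nonadj adj v w"
    | "n = k + 3" "{j. \<not> adj u j} = {u, v, z}" "w = u" "s = 2" "z \<noteq> v"
    | "n = k + 3" "{j. \<not> adj u j} = {u, v, w}" "z = v" "s = 1 / 2" "w \<noteq> u"
    | "n = k + 4" "{j. \<not> adj u j} = {u, v, w, z}" "s = 1"
    unfolding x y by metis
  then show ?thesis
  proof cases
    case 1
    then have "is_CP adj m" using P by (auto simp: is_CP_def)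
    then have "CP_states adj x y"
      using CP_statesI[OF _ m2 m assms(2-4) 1(2,3) x y] by blast
    then show ?thesis ..
  next
    case 2
    then have "is_CP adj m" using P by (auto simp: is_CP_def)
    \<comment> \<open>With s = 1 the names of w and z may be exchanged.\<close>
    moreover have "y = ev z + s *\<^sub>R ev w" using y 2 by (simp add: add.commute)
    ultimately have "CP_states adj x y"
      using CP_statesI[OF _ m2 m assms(2) assms(3)[symmetric] assms(4) 2(3,4) x] by blast
    then show ?thesis ..
  next
    case 3
    then have "complete_multipartite adj P m 3" using P by simp
    moreover have "{v, u, z} \<in> P" using parts[of u] 3 by (simp add: insert_commute)
    moreover have "x = 2 *\<^sub>R ev v + ev u" "y = 2 *\<^sub>R ev z + ev u"
      using x y 3 by (simp_all add: add.commute)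
    moreover have "v \<noteq> u" "z \<noteq> u" using 3 assms(2,3) by auto
    ultimately have "K3_states adj x y"
      using K3_statesI[OF m, of P v u z x y] by simp
    then show ?thesis by blast
  next
    case 4
    then have "complete_multipartite adj P m 3" using P by simp
    moreover have "{u, v, w} \<in> P" using parts[of u] 4 by simp
    moreover have "x = ev u + (1/2) *\<^sub>R ev v" "y = ev w + (1/2) *\<^sub>R ev v"
      using x y 4 by simp_all
    moreover have "w \<noteq> v" using 4 assms(3) by auto
    ultimately have "K3_states adj x y"
      using K3_statesI[OF m, of P u v w x y] assms(2) by simp
    then show ?thesis by blast
  next
    case 5
    then have "complete_multipartite adj P m 4" using P by simp
    moreover have "{u, v, w, z} \<in> P" using parts[of u] 5 by simp
    moreover have "x = ev u + ev v" "y = ev w + ev z"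
      using x y 5 by simp_all
    ultimately have "K4_states adj x y"
      by (rule K4_statesI[OF m])
    then show ?thesis by blast
  qed
qed

text \<open>For y = R x the mate of u is w rather than z, so w and z exchange names and y changes
  sign; for y = - R x the names already fit.\<close>

lemma antisymmetric_states:
  assumes ck: "c = k" and nk: "n = k + 2" and "u \<noteq> v" "w \<noteq> z"
    and x: "x = ev u - ev v" and y: "y = ev w - ev z"
    and R: "y = R x \<or> y = - R x" and "y \<noteq> x" "y \<noteq> - x"
  shows "CP_states adj x y"
proof -
  obtain w' z' where wz: "w' \<noteq> z'" "nonadj adj u z'" "nonadj adj v w'" "same_state y (ev w' - ev z')"
    using R
  proof
    assume Rx: "y = R x"
    have "nonadj adj u w \<and> nonadj adj v z"
      using reflected_pair_states[OF ck assms(3,4), of "- 1"] Rx assms(8,9) nk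
      unfolding x y by auto
    then show thesis
      using assms(4) y by (intro that[of z w]) (auto simp: same_state_def)
  next
    assume Rx: "y = - R x"
    then have "R x = - y" by simp
    then have "R (ev u + (- 1) *\<^sub>R ev v) = ev z + (- 1) *\<^sub>R ev w"
      unfolding x y by simp
    then have "nonadj adj u z \<and> nonadj adj v w"
      using reflected_pair_states[OF ck assms(3) assms(4)[symmetric], of "- 1"] assms(8,9) nk
      unfolding x y by (auto simp: algebra_simps)
    then show thesis
      using assms(4) y by (intro that[of w z]) (auto simp: same_state_def)
  qed
  obtain P m where "complete_multipartite adj P m (n - k)"
    using complete_multipartite_exists[OF ck] by blast
  then have "is_CP adj m" "m \<ge> 2" using nk by (auto simp: is_CP_def complete_multipartite_def)
  then show ?thesis
    using CP_states_antisymmetricI[OF _ _ assms(3) wz(1-3) x wz(4)] by blast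
qed

lemma pst_imp_states:
  assumes "u \<noteq> v" "w \<noteq> z" "s \<noteq> 0"
    and x: "x = ev u + s *\<^sub>R ev v" and y: "y = ev w + s *\<^sub>R ev z"
    and ne: "y \<noteq> x" "y \<noteq> - x" and pst: "pst_at adj x y t"
  shows "C4_states adj x y \<or> CP_states adj x y \<or> K3_states adj x y \<or> K4_states adj x y"
proof -
  obtain \<gamma> where ph: "phases \<gamma> x y t" using pst by (auto simp: pst_at_iff_phases)
  have norms: "norm x = norm y" using assms(1,2) by (simp add: x y norm_pair_state)
  have x0: "x \<noteq> 0"
  proof
    assume "x = 0"
    then have "x $ u = 0" by simp
    then show False using assms(1) by (simp add: x ev_nth)
  qed
  have tots: "tot x = 1 + s" "tot y = tot x" by (simp_all add: x y)
  have mean: "mean x = (1 + s) / real n" by (simp add: mean_def tots)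
  have four: ?thesis if "n = 4" "distinct [u, v, w, z]" "s = 1"
    using complement_states[OF that(1,2)] that(3) x y by auto
  have Ax: "(A *v x) $ i = of_bool (adj i u) + s * of_bool (adj i v)"
    and Ay: "(A *v y) $ i = of_bool (adj i w) + s * of_bool (adj i z)" for i
    by (simp_all add: x y matrix_vector_right_distrib matrix_vector_mult_scaleR A_ev)
  from transfer_equation[OF ph norms x0 tots(2) ne(1)] show ?thesis
  proof
    assume comp: "y = (2 * mean x) *\<^sub>R ones - x"
    have s1: "mean x \<noteq> 0" using comp ne(2) by auto
    have sum: "x $ i + y $ i = 2 * mean x" for i
      using arg_cong[OF comp, of "\<lambda>v. v $ i"] by simp
    \<comment> \<open>The sum of x and y is a nonzero constant, but it vanishes outside the four
      vertices; so there are no others.\<close>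
    have "i \<in> {u, v, w, z}" for i
    proof (rule ccontr)
      assume "i \<notin> {u, v, w, z}"
      then have "x $ i + y $ i = 0" by (simp add: x y ev_nth)
      then show False using sum[of i] s1 by simp
    qed
    then have "UNIV = {u, v, w, z}" by auto
    then have "n = card {u, v, w, z}" using card_vertices by simp
    then have "n = 4 \<and> distinct [u, v, w, z]"
      using k_ge k_le card_length[of "[u, v, w, z]"] card_distinct[of "[u, v, w, z]"] by simp
    then have n4: "n = 4" and dist: "distinct [u, v, w, z]" by auto
    have "s = 1" using sum[of u] sum[of v] dist by (auto simp: x y ev_nth)
    then show ?thesis using four n4 dist by blast
  next
    assume "\<exists>e. (e = D \<or> e = - D) \<and>
      (\<forall>i. 2 * (A *v x) $ i = d * x $ i + e * y $ i + (2 * real k - d - e) * mean x) \<and>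
      (\<forall>i. 2 * (A *v y) $ i = d * y $ i + e * x $ i + (2 * real k - d - e) * mean x)"
    then obtain e where e: "e = D \<or> e = - D"
      and E1: "\<And>i. 2 * (A *v x) $ i = d * x $ i + e * y $ i + (2 * real k - d - e) * mean x"
      and E2: "\<And>i. 2 * (A *v y) $ i = d * y $ i + e * x $ i + (2 * real k - d - e) * mean x"
      by blast
    define \<beta> where "\<beta> = (2 * real k - d - e) * mean x"
    have eqs: "adjacency_equation e \<beta> u v w z s" "adjacency_equation e \<beta> w z u v s"
      using E1 E2 unfolding adjacency_equation_def \<beta>_def Ax Ay by (simp_all add: x y ev_nth)
    have e2: "e\<^sup>2 = D\<^sup>2" using e by auto
    show ?thesis
    proof (cases "s = - 1")
      case True
      then have \<beta>0: "\<beta> = 0" by (simp add: \<beta>_def mean)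
      have nswap: "\<not> (w = u \<and> z = v)" "\<not> (w = v \<and> z = u)"
        using ne True by (auto simp: x y)
      have ck: "c = k" and nk: "n = k + 2"
        using adjacency_equation_antisymmetric[of e u v w z] eqs(1) \<beta>0 True e2 assms(1,2) nswap
        by simp_all
      have p2: "real n - real k = 2" using nk by simp
      have Rx: "R x $ i = - (A *v x) $ i - x $ i" for i
        unfolding R_def p2 using tots(1) True by simp
      have "d = - 2" "D = 2" using d_eq[OF ck] D_eq[OF ck] nk by simp_all
      then have eq: "2 * (A *v x) $ i = - 2 * x $ i + e * y $ i" for i
        using E1[of i] \<beta>0 by (simp add: \<beta>_def)
      \<comment> \<open>With mean zero, flipping the component at 0 is \<open>R\<close> and flipping
        the one at -2 is its negative.\<close>
      have "y = R x \<or> y = - R x"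
        if "e = 2 \<or> e = - 2"
        using that
      proof
        assume "e = 2"
        then have "y $ i = (- R x) $ i" for i using eq[of i] by (simp add: Rx)
        then show ?thesis by (simp add: vec_eq_iff)
      next
        assume "e = - 2"
        then have "y $ i = R x $ i" for i using eq[of i] by (simp add: Rx)
        then show ?thesis by (simp add: vec_eq_iff)
      qed
      then have "CP_states adj x y"
        using antisymmetric_states[OF ck nk assms(1,2), of x y] True x y ne e \<open>D = 2\<close> by simp
      then show ?thesis by blast
    next
      case False
      have m0: "mean x \<noteq> 0" using False n_pos by (simp add: mean)
      \<comment> \<open>Vanishing would mean k = \<Theta> or k = \<Lambda>.\<close>
      have "2 * real k - d - e \<noteq> 0"
        using e eigenvalues_distinct by (auto simp: \<Theta>_def \<Lambda>_def field_simps)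
      then have \<beta>0: "\<beta> \<noteq> 0" using m0 by (simp add: \<beta>_def)
      show ?thesis
      proof (cases "n = 4 \<and> s = 1 \<and> distinct [u, v, w, z]")
        case True
        then show ?thesis using four by blast
      next
        case not_four: False
        have nswap: "\<not> (w = u \<and> z = v)" "\<not> (s = 1 \<and> w = v \<and> z = u)"
          using ne(1) by (auto simp: x y add.commute)
        have ed: "e = d"
          using adjacency_equation_imp_e_eq_d[OF eqs e2 \<beta>0 assms(3,1,2) nswap] not_four by blast
        then have ck: "c = k" using e2 D_squared by simp
        have "y $ i = R x $ i" for i
        proof -
          let ?p = "real n - real k"
          have d: "d = - ?p" by (rule d_eq[OF ck])
          have "tot x = real n * mean x" using n_pos by (simp add: mean_def)
          moreover have "2 * (A *v x) $ i = - ?p * (x $ i + y $ i) + 2 * (real n * mean x)"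
            using E1[of i] unfolding ed d by (simp add: algebra_simps)
          ultimately have "?p * (x $ i + y $ i) = 2 * (tot x - (A *v x) $ i)"
            by (simp add: algebra_simps)
          then have "x $ i + y $ i = 2 / ?p * (tot x - (A *v x) $ i)"
            using part_size_pos[OF ck] by (simp add: field_simps)
          then show ?thesis by (simp add: R_def)
        qed
        then have "y = R x" by (simp add: vec_eq_iff)
        then show ?thesis
          using reflected_states[OF ck assms(1-3) False x y _ ne pst] by blast
      qed
    qed
  qed
qed

end

theorem theorem6:
  fixes adj :: "'v::finite \<Rightarrow> 'v \<Rightarrow> bool"
    and n k a c :: nat
    and u v w z :: 'v
    and s :: real
    and x y :: "real^'v"
  assumes "strongly_regular adj n k a c"
    and "connected_graph adj"
    and "u \<noteq> v" and "w \<noteq> z" and "s \<noteq> 0"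
    and "x = ev u + s *\<^sub>R ev v"
    and "y = ev w + s *\<^sub>R ev z"
    and "y \<noteq> x" and "y \<noteq> - x"
  shows "(pst adj x y \<longleftrightarrow>
            C4_states adj x y \<or> CP_states adj x y \<or> K3_states adj x y \<or> K4_states adj x y)
       \<and> (C4_states adj x y \<longrightarrow> min_pst_time adj x y (pi / 4))
       \<and> (CP_states adj x y \<longrightarrow> min_pst_time adj x y (pi / 2))
       \<and> (K3_states adj x y \<longrightarrow> min_pst_time adj x y (pi / 3))
       \<and> (K4_states adj x y \<longrightarrow> min_pst_time adj x y (pi / 4))"
proof -
  interpret connected_srg adj n k a c
    using assms(1,2) by unfold_locales
  have times:
    "C4_states adj x y \<Longrightarrow> min_pst_time adj x y (pi / 4)"
    "CP_states adj x y \<Longrightarrow> min_pst_time adj x y (pi / 2)"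
    "K3_states adj x y \<Longrightarrow> min_pst_time adj x y (pi / 3)"
    "K4_states adj x y \<Longrightarrow> min_pst_time adj x y (pi / 4)"
    using C4_states_min_pst_time CP_states_min_pst_time K3_states_min_pst_time
      K4_states_min_pst_time assms(8,9)
    by blast+
  have "pst adj x y"
    if "C4_states adj x y \<or> CP_states adj x y \<or> K3_states adj x y \<or> K4_states adj x y"
    using that times by (auto simp: pst_def min_pst_time_def)
  moreover have "C4_states adj x y \<or> CP_states adj x y \<or> K3_states adj x y \<or> K4_states adj x y"
    if "pst adj x y"
    using that pst_imp_states[OF assms(3-9)] by (auto simp: pst_def)
  ultimately show ?thesis using times by blast
qed

end
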